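(* Let $\alpha>0$ be irrational, and consider dissipative flow of slope $\alpha$ on a system $\mathcal{P}$ obtained from a finite polysquare translation surface by the inclusion of a one-sided barrier $B$ on the common vertical edge of two neighbouring atomic squares, in the form of a union of finitely many vertical intervals, where a set $A$ corresponding to $B$ has been chosen on a different vertical edge on the same horizontal street that contains $B$. Suppose further that the endpoints of the vertical intervals that make up the one-sided barrier $B$ all have rational $y$-coordinates. Then the extension process terminates after a finite number of steps, and both the transient set $\mathcal{W}(\mathcal{P};\alpha)$ and the recurrent set $\mathcal{R}(\mathcal{P};\alpha)$ are finite unions of polygons with boundary edges that are vertical or of slope $\alpha$.
   Context: A finite polysquare translation surface is a connected surface obtained from finitely many axis-parallel unit squares (atomic squares) by identifying right edges with left edges, and top edges with bottom edges, in pairs by translation; the vertices of the squares have integer coordinates. A horizontal street is a maximal (cyclic) chain of atomic squares successively adjacent through vertical edges. Each vertical edge is identified with $[0,1)$ by relative height $y$. The barrier is $B=J$ on one vertical edge (common to two neighbouring atomic squares) and $A$ is the corresponding copy of $J$, at the same heights, on a different vertical edge of the same horizontal street, where $J\subset[0,1)$ is a union of finitely many intervals of positive length. Dissipative flow of slope $\alpha$ on $\mathcal{P}$: a flow line moves from left to right at unit speed in direction $(1,\alpha)$ as the ordinary geodesic flow on the surface, except that whenever it hits a point of $B$ from the left it continues, in the same direction, from the corresponding point (same height) of $A$. (A flow line that starts on $B$ emanates from the right side of $B$.) Flow lines that hit a singularity where the continuation is undefined come from a set of measure $0$ and are ignored. For $t\ge0$, $\mathbf{T}_\alpha^{(t)}$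 advances a point along its dissipative flow line by time $t$. A point $P\in\mathcal{P}$ is wandering if there exist an open neighbourhood $D$ of $P$ and $t_0\ge0$ with $D\cap\mathbf{T}_\alpha^{(t)}(D)=\emptyset$ for every $t>t_0$; otherwise it is non-wandering. $\mathcal{W}(\mathcal{P};\alpha)$ (transient set) is the set of wandering points and $\mathcal{R}(\mathcal{P};\alpha)$ (recurrent set) is the set of non-wandering points. Extension process. Let $X$ be the union of the left vertical edges of all atomic squares, and let $\mathbf{T}:X\to X$ be the discretization of the ordinary (barrier-free) geodesic flow of slope $\alpha$ on the surface, i.e. each point is mapped to the next point of $X$ on its geodesic. For $x\in A\cup B$ let $n(x)=\min\{n\ge1:\mathbf{T}^n(x)\in A\cup B\}$ and $\mathbf{T}^*(x)=\mathbf{T}^{n(x)}(x)$, so $\mathbf{T}^*:A\cup B\to A\cup B$ is the first return map (defined almost everywhere). For $S\subset A\cup B$ let $\mathcal{F}(S)$ be the set of all points of $\mathcal{P}$ swept out by starting from the points of $S$ and moving with the ordinary geodesic flow of slope $\alpha$ until $A\cup B$ is hit again for the first time. For $H\subset A\cup B$ let $y(H)$ be the set of heights of points of $H$. Put $A_0=A$ and, for $i\ge1$, let $A_i\subset A_{i-1}$ be defined by $y(A_i)=y(\mathbf{T}^*(A_{i-1})\cap(A\cup B))$. The process starts with $\mathcal{F}(B)$, and in the $i$-th step the set $\mathcal{F}(A_{i-1}\setminus A_i)$ is added to it. The process terminates after a finite number of steps if $A_{i-1}\setminus A_i$ has measure $0$ for some $i\ge1$. In the description of sets as finite unions of polygons,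 sets of $2$-dimensional Lebesgue measure $0$ are disregarded. *)

theory Defs
  imports "HOL-Analysis.Analysis"
begin

section \<open>Finite polysquare translation surfaces\<close>

text \<open>
  The atomic squares are the elements of a finite type. The right edge of a square \<open>s\<close> is glued to
  the left edge of \<open>r s\<close> and its top edge to the bottom edge of \<open>u s\<close>.
\<close>

definition polysquare :: "('s::finite \<Rightarrow> 's) \<Rightarrow> ('s \<Rightarrow> 's) \<Rightarrow> bool" where
  "polysquare r u \<longleftrightarrow> bij r \<and> bij u \<and>
     (let E = {(s, r s) | s. True} \<union> {(s, u s) | s. True}
      in \<forall>s t. (s, t) \<in> (E \<union> E\<inverse>)\<^sup>*)"

definition street :: "('s \<Rightarrow> 's) \<Rightarrow> 's \<Rightarrow> 's set" where
  "street r s = {(r ^^ k) s | k. True}"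

type_synonym 's pt = "'s \<times> real \<times> real"

definition closed_square :: "(real \<times> real) set" where
  "closed_square = {0..1} \<times> {0..1}"

text \<open>
  A point of the surface is a class of points of the closed squares: two points on an edge, or all
  the corners of squares that meet at a vertex, are the same point.
\<close>

definition glue :: "('s \<Rightarrow> 's) \<Rightarrow> ('s \<Rightarrow> 's) \<Rightarrow> ('s pt \<times> 's pt) set" where
  "glue r u = {((s, 1, y), (r s, 0, y)) | s y. y \<in> {0..1}} \<union>
              {((s, x, 1), (u s, x, 0)) | s x. x \<in> {0..1}}"

definition surface_pt :: "('s \<Rightarrow> 's) \<Rightarrow> ('s \<Rightarrow> 's) \<Rightarrow> 's pt \<Rightarrow> 's pt set" where
  "surface_pt r u p = (glue r u \<union> (glue r u)\<inverse>)\<^sup>* `` {p}"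

definition surface :: "('s \<Rightarrow> 's) \<Rightarrow> ('s \<Rightarrow> 's) \<Rightarrow> 's pt set set" where
  "surface r u = surface_pt r u ` (UNIV \<times> closed_square)"

definition part_in_square :: "('s \<Rightarrow> 's) \<Rightarrow> ('s \<Rightarrow> 's) \<Rightarrow> 's pt set set \<Rightarrow> 's \<Rightarrow> (real \<times> real) set" where
  "part_in_square r u M s = {z \<in> closed_square. surface_pt r u (s, z) \<in> M}"

text \<open>The quotient topology.\<close>

definition surface_open :: "('s \<Rightarrow> 's) \<Rightarrow> ('s \<Rightarrow> 's) \<Rightarrow> 's pt set set \<Rightarrow> bool" where
  "surface_open r u D \<longleftrightarrow> D \<subseteq> surface r u \<and>
     (\<forall>s. openin (top_of_set closed_square) (part_in_square r u D s))"

definition surface_null :: "('s \<Rightarrow> 's) \<Rightarrow> ('s \<Rightarrow> 's) \<Rightarrow> 's pt set set \<Rightarrow> bool" where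
  "surface_null r u M \<longleftrightarrow> (\<forall>s. part_in_square r u M s \<in> null_sets lebesgue)"

section \<open>Flows of positive slope\<close>

text \<open>
  The vertex at the lower left corner of \<open>c\<close> has cone angle \<open>2 * pi\<close> iff going right and then up to
  \<open>c\<close> starts from the same square as going up and then right to \<open>c\<close>. All other vertices are
  singularities.
\<close>

definition regular_corner :: "('s \<Rightarrow> 's) \<Rightarrow> ('s \<Rightarrow> 's) \<Rightarrow> 's \<Rightarrow> bool" where
  "regular_corner r u c \<longleftrightarrow> (\<exists>s. c = u (r s) \<and> c = r (u s))"

text \<open>
  Every nonsingular point of the surface has exactly one representative of the following form,
  from which a line of positive slope starts inside the same square.
\<close>

definition start_pt :: "('s \<Rightarrow> 's) \<Rightarrow> ('s \<Rightarrow> 's) \<Rightarrow> 's \<Rightarrow> real \<Rightarrow> real \<Rightarrow> bool" where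
  "start_pt r u s x y \<longleftrightarrow> 0 \<le> x \<and> x < 1 \<and> 0 \<le> y \<and> y < 1 \<and>
     (x = 0 \<and> y = 0 \<longrightarrow> regular_corner r u s)"

text \<open>
  \<open>flow r u \<alpha> e t p q\<close>: the flow line of direction \<open>(1, \<alpha>)\<close> and unit speed that starts at \<open>p\<close> is
  at \<open>q\<close> after time \<open>t\<close>, where a line that is about to enter the square \<open>c\<close> through its left edge at
  height \<open>y\<close> continues instead in the square \<open>e c y\<close>, from the same height of its left edge. For
  \<open>e c y = c\<close> this is the geodesic flow. The variable \<open>h\<close> is the horizontal distance covered. Lines
  end when they hit a singularity.
\<close>

inductive flow :: "('s \<Rightarrow> 's) \<Rightarrow> ('s \<Rightarrow> 's) \<Rightarrow> real \<Rightarrow> ('s \<Rightarrow> real \<Rightarrow> 's) \<Rightarrow>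
    real \<Rightarrow> 's pt \<Rightarrow> 's pt \<Rightarrow> bool"
  for r u :: "'s \<Rightarrow> 's" and \<alpha> :: real and e :: "'s \<Rightarrow> real \<Rightarrow> 's" where
  inside_square:
    "\<lbrakk>start_pt r u s x y; 0 \<le> h; x + h < 1; y + \<alpha> * h < 1\<rbrakk> \<Longrightarrow>
     flow r u \<alpha> e (h * sqrt (1 + \<alpha>\<^sup>2)) (s, x, y) (s, x + h, y + \<alpha> * h)"
| right_edge:
    "\<lbrakk>start_pt r u s x y; x + h = 1; y + \<alpha> * h < 1;
      flow r u \<alpha> e t (e (r s) (y + \<alpha> * h), 0, y + \<alpha> * h) q\<rbrakk> \<Longrightarrow>
     flow r u \<alpha> e (h * sqrt (1 + \<alpha>\<^sup>2) + t) (s, x, y) q"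
| top_edge:
    "\<lbrakk>start_pt r u s x y; x + h < 1; y + \<alpha> * h = 1;
      flow r u \<alpha> e t (u s, x + h, 0) q\<rbrakk> \<Longrightarrow>
     flow r u \<alpha> e (h * sqrt (1 + \<alpha>\<^sup>2) + t) (s, x, y) q"
| regular_vertex:
    "\<lbrakk>start_pt r u s x y; x + h = 1; y + \<alpha> * h = 1; u (r s) = r (u s);
      flow r u \<alpha> e t (e (r (u s)) 0, 0, 0) q\<rbrakk> \<Longrightarrow>
     flow r u \<alpha> e (h * sqrt (1 + \<alpha>\<^sup>2) + t) (s, x, y) q"

definition geodesic_flow :: "('s \<Rightarrow> 's) \<Rightarrow> ('s \<Rightarrow> 's) \<Rightarrow> real \<Rightarrow>
    real \<Rightarrow> 's pt \<Rightarrow> 's pt \<Rightarrow> bool" where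
  "geodesic_flow r u \<alpha> = flow r u \<alpha> (\<lambda>c y. c)"

text \<open>
  The barrier \<open>B\<close> is the part with heights \<open>J\<close> of the left edge of the square \<open>b\<close>, and \<open>A\<close> is the
  corresponding part of the left edge of the square \<open>a\<close>. A line that hits \<open>B\<close> at time \<open>t\<close> is
  at the point of \<open>A\<close> at time \<open>t\<close>.
\<close>

definition dissipative_flow :: "('s \<Rightarrow> 's) \<Rightarrow> ('s \<Rightarrow> 's) \<Rightarrow> real \<Rightarrow> 's \<Rightarrow> 's \<Rightarrow> real set \<Rightarrow>
    real \<Rightarrow> 's pt \<Rightarrow> 's pt \<Rightarrow> bool" where
  "dissipative_flow r u \<alpha> a b J =
     flow r u \<alpha> (\<lambda>c y. if c = b \<and> y \<in> J then a else c)"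

text \<open>The image of \<open>D\<close> under the partial map that advances points by time \<open>t\<close>.\<close>

definition dissipative_image :: "('s \<Rightarrow> 's) \<Rightarrow> ('s \<Rightarrow> 's) \<Rightarrow> real \<Rightarrow> 's \<Rightarrow> 's \<Rightarrow> real set \<Rightarrow>
    real \<Rightarrow> 's pt set set \<Rightarrow> 's pt set set" where
  "dissipative_image r u \<alpha> a b J t D =
     {surface_pt r u q | p q. surface_pt r u p \<in> D \<and> dissipative_flow r u \<alpha> a b J t p q}"

definition wandering :: "('s \<Rightarrow> 's) \<Rightarrow> ('s \<Rightarrow> 's) \<Rightarrow> real \<Rightarrow> 's \<Rightarrow> 's \<Rightarrow> real set \<Rightarrow>
    's pt set \<Rightarrow> bool" where
  "wandering r u \<alpha> a b J P \<longleftrightarrow>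
     (\<exists>D t0. surface_open r u D \<and> P \<in> D \<and> 0 \<le> t0 \<and>
        (\<forall>t>t0. D \<inter> dissipative_image r u \<alpha> a b J t D = {}))"

definition transient_set :: "('s \<Rightarrow> 's) \<Rightarrow> ('s \<Rightarrow> 's) \<Rightarrow> real \<Rightarrow> 's \<Rightarrow> 's \<Rightarrow> real set \<Rightarrow>
    's pt set set" where
  "transient_set r u \<alpha> a b J = {P \<in> surface r u. wandering r u \<alpha> a b J P}"

definition recurrent_set :: "('s \<Rightarrow> 's) \<Rightarrow> ('s \<Rightarrow> 's) \<Rightarrow> real \<Rightarrow> 's \<Rightarrow> 's \<Rightarrow> real set \<Rightarrow>
    's pt set set" where
  "recurrent_set r u \<alpha> a b J = {P \<in> surface r u. \<not> wandering r u \<alpha> a b J P}"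

section \<open>The extension process\<close>

text \<open>
  The point at height \<open>y \<in> [0, 1)\<close> of the left edge of the square \<open>s\<close> is written \<open>(s, y)\<close>. The
  maps between such points are partial, and are given as relations.
\<close>

definition next_edge_pt :: "('s \<Rightarrow> 's) \<Rightarrow> ('s \<Rightarrow> 's) \<Rightarrow> real \<Rightarrow> (('s \<times> real) \<times> ('s \<times> real)) set" where
  "next_edge_pt r u \<alpha> = {((s, y), (s', y')).
     \<exists>t>0. geodesic_flow r u \<alpha> t (s, 0, y) (s', 0, y') \<and>
       (\<forall>t' s'' y''. 0 < t' \<and> t' < t \<longrightarrow> \<not> geodesic_flow r u \<alpha> t' (s, 0, y) (s'', 0, y''))}"

definition first_return :: "('x \<times> 'x) set \<Rightarrow> 'x set \<Rightarrow> ('x \<times> 'x) set" where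
  "first_return T E = {(x, z). x \<in> E \<and> z \<in> E \<and>
     (\<exists>n\<ge>1. (x, z) \<in> T ^^ n \<and> (\<forall>m w. 1 \<le> m \<and> m < n \<and> (x, w) \<in> T ^^ m \<longrightarrow> w \<notin> E))}"

primrec A_seq :: "('s \<Rightarrow> 's) \<Rightarrow> ('s \<Rightarrow> 's) \<Rightarrow> real \<Rightarrow> 's \<Rightarrow> 's \<Rightarrow> real set \<Rightarrow> nat \<Rightarrow> ('s \<times> real) set"
  where
  "A_seq r u \<alpha> a b J 0 = {a} \<times> J"
| "A_seq r u \<alpha> a b J (Suc i) =
     (let E = {a} \<times> J \<union> {b} \<times> J
      in {a} \<times> snd ` (first_return (next_edge_pt r u \<alpha>) E `` A_seq r u \<alpha> a b J i \<inter> E))"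

text \<open>
  Step \<open>i\<close> of the process adds the set swept out by the geodesics from \<open>A_seq (i - 1) - A_seq i\<close>
  to their first return; whether the process stops depends only on the size of this difference.
\<close>

definition extension_process_terminates ::
  "('s \<Rightarrow> 's) \<Rightarrow> ('s \<Rightarrow> 's) \<Rightarrow> real \<Rightarrow> 's \<Rightarrow> 's \<Rightarrow> real set \<Rightarrow> bool" where
  "extension_process_terminates r u \<alpha> a b J \<longleftrightarrow>
     (\<exists>i\<ge>1. snd ` (A_seq r u \<alpha> a b J (i - 1) - A_seq r u \<alpha> a b J i) \<in> null_sets lebesgue)"

section \<open>Polygons\<close>

fun polygonal_path :: "'a::real_normed_vector list \<Rightarrow> real \<Rightarrow> 'a" where
  "polygonal_path [] = linepath 0 0"
| "polygonal_path [v] = linepath v v"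
| "polygonal_path [v, w] = linepath v w"
| "polygonal_path (v # w # x # vs) = linepath v w +++ polygonal_path (w # x # vs)"

text \<open>The vertices of a simple closed polygon in order, the first one being repeated at the end.\<close>

definition closed_polygon :: "(real \<times> real) list \<Rightarrow> bool" where
  "closed_polygon vs \<longleftrightarrow> vs \<noteq> [] \<and> hd vs = last vs \<and> simple_path (polygonal_path vs)"

definition edges_vertical_or_slope :: "real \<Rightarrow> (real \<times> real) list \<Rightarrow> bool" where
  "edges_vertical_or_slope \<alpha> vs \<longleftrightarrow>
     (\<forall>i. Suc i < length vs \<longrightarrow>
        fst (vs ! Suc i) = fst (vs ! i) \<or>
        snd (vs ! Suc i) - snd (vs ! i) = \<alpha> * (fst (vs ! Suc i) - fst (vs ! i)))"

text \<open>
  A map of a planar open set \<open>U\<close> into the surface that is a translation near each point, in each of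
  the squares that meet there. Such a map cannot hit a singularity, since the squares around a
  singularity impose contradictory conditions.
\<close>

definition local_translation :: "('s \<Rightarrow> 's) \<Rightarrow> ('s \<Rightarrow> 's) \<Rightarrow> (real \<times> real) set \<Rightarrow>
    (real \<times> real \<Rightarrow> 's pt set) \<Rightarrow> bool" where
  "local_translation r u U f \<longleftrightarrow> f ` U \<subseteq> surface r u \<and>
     (\<forall>z\<in>U. \<forall>s. \<forall>w\<in>closed_square. f z = surface_pt r u (s, w) \<longrightarrow>
        (\<exists>\<epsilon>>0. \<forall>h. norm h < \<epsilon> \<and> w + h \<in> closed_square \<longrightarrow> f (z + h) = surface_pt r u (s, w + h)))"

text \<open>
  A polygon may extend over several squares, so it is the image of a planar polygon placed on the
  surface without overlaps. Its boundary, a null set that may contain singularities, is left out.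
\<close>

definition surface_polygon :: "('s \<Rightarrow> 's) \<Rightarrow> ('s \<Rightarrow> 's) \<Rightarrow> real \<Rightarrow> 's pt set set \<Rightarrow> bool" where
  "surface_polygon r u \<alpha> Q \<longleftrightarrow>
     (\<exists>vs f. closed_polygon vs \<and> edges_vertical_or_slope \<alpha> vs \<and>
        (let U = inside (path_image (polygonal_path vs))
         in local_translation r u U f \<and> inj_on f U \<and> Q = f ` U))"

definition finite_union_of_polygons :: "('s \<Rightarrow> 's) \<Rightarrow> ('s \<Rightarrow> 's) \<Rightarrow> real \<Rightarrow> 's pt set set \<Rightarrow> bool" where
  "finite_union_of_polygons r u \<alpha> M \<longleftrightarrow>
     (\<exists>F. finite F \<and> (\<forall>Q\<in>F. surface_polygon r u \<alpha> Q) \<and>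
        surface_null r u (M - \<Union>F) \<and> surface_null r u (\<Union>F - M))"

section \<open>Barriers\<close>

text \<open>A nondegenerate interval, with or without each of its endpoints, both of which are rational.\<close>

definition rational_interval :: "real set \<Rightarrow> bool" where
  "rational_interval I \<longleftrightarrow>
     (\<exists>c d. c \<in> \<rat> \<and> d \<in> \<rat> \<and> c < d \<and> {c<..<d} \<subseteq> I \<and> I \<subseteq> {c..d})"

end

theory Submission
  imports Defs
begin

text \<open>Read off at the left edges, a flow of slope \<open>\<alpha>\<close> is a cocycle over the rotation by \<open>\<alpha>\<close>: the
  height moves by \<open>\<alpha>\<close> modulo 1, and the square changes by a map of the finite set of squares that is
  a piecewise constant function of the height. The barrier makes these maps noninjective. Over each
  height, the set of squares that are still reached after \<open>n\<close> steps decreases with \<open>n\<close>, and its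
  cardinality cannot increase along the rotation. Its minimum is attained on an interval, which
  every orbit of the irrational rotation hits within a bounded time, so the decreasing sets are
  constant after a bounded number of steps, at all but countably many heights. The limit sets form
  the attractor: its points are recurrent, since the cocycle permutes it; the points outside are
  wandering, since nothing returns there; and the sets \<open>A\<^sub>i\<close> decrease to its part on \<open>A\<close>. In
  each square the attractor is a finite union of intervals, which sweep out parallelograms.\<close>

section \<open>Piecewise constant functions of a real variable\<close>

text \<open>Heights are real numbers and the cocycle has period 1, so the rotation is a plain
  translation. Dynamical statements are made at generic heights, whose two-sided orbits avoid
  vertices and discontinuities; the remaining heights are countably many and sweep out a null set.
  The obstacle is that wandering is a topological notion, while every neighbourhood contains
  nongeneric lines. For wandering points this is met by inclusions between image sets that hold at
  every height; for nonwandering points one generic line close to the given one suffices. The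
  counting principle \<open>minimum_spreads\<close> is used twice: on the cardinality of the
  shrinking images, where constancy makes the step maps injective, and on the number of squares not
  yet reached from a target, where constancy forces a return. The second use takes the place of an
  invariant measure and yields returns at every generic height.\<close>

definition locally_const :: "(real \<Rightarrow> 'a) \<Rightarrow> real \<Rightarrow> bool" where
  "locally_const f v \<longleftrightarrow> (\<forall>\<^sub>F w in nhds v. f w = f v)"

text \<open>Functions live on the whole line, where each discontinuity on the circle recurs with
  period 1, so finiteness can be asked only on bounded intervals.\<close>

definition piecewise_const :: "(real \<Rightarrow> 'a) \<Rightarrow> bool" where
  "piecewise_const f \<longleftrightarrow> (\<forall>x y. finite {v \<in> {x..y}. \<not> locally_const f v})"

lemma locally_constI:
  assumes "open U" "v \<in> U" "\<And>w. w \<in> U \<Longrightarrow> f w = f v"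
  shows "locally_const f v"
  using assms unfolding locally_const_def eventually_nhds by blast

lemma locally_constE:
  assumes "locally_const f v"
  obtains \<epsilon> where "\<epsilon> > 0" "\<And>w. \<bar>w - v\<bar> < \<epsilon> \<Longrightarrow> f w = f v"
  using assms unfolding locally_const_def eventually_nhds_metric dist_real_def by blast

lemma locally_const_const: "locally_const (\<lambda>_. c) v"
  unfolding locally_const_def by simp

lemma locally_const_comp: "locally_const f v \<Longrightarrow> locally_const (\<lambda>w. h (f w)) v"
  unfolding locally_const_def by (auto elim: eventually_mono)

lemma locally_const_comp2:
  "locally_const f v \<Longrightarrow> locally_const g v \<Longrightarrow> locally_const (\<lambda>w. h (f w) (g w)) v"
  unfolding locally_const_def by (auto elim: eventually_elim2)

lemma locally_const_shift:
  assumes "locally_const f (v + d)"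
  shows "locally_const (\<lambda>w. f (w + d)) v"
proof -
  obtain \<epsilon> where e: "\<epsilon> > 0" "\<And>w. \<bar>w - (v + d)\<bar> < \<epsilon> \<Longrightarrow> f w = f (v + d)"
    using assms locally_constE by blast
  show ?thesis
  proof (rule locally_constI)
    show "open (ball v \<epsilon>)" "v \<in> ball v \<epsilon>" using e(1) by simp_all
    show "f (w + d) = f (v + d)" if "w \<in> ball v \<epsilon>" for w
      by (rule e(2)) (use that in \<open>simp add: dist_real_def\<close>)
  qed
qed

lemma locally_const_floor: "v \<notin> \<int> \<Longrightarrow> locally_const floor v"
  using floor_correct[of v]
  by (intro locally_constI[of "{of_int \<lfloor>v\<rfloor><..<of_int \<lfloor>v\<rfloor> + 1}"])
    (auto simp: less_le intro: floor_unique)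

lemma piecewise_const_finite:
  "piecewise_const f \<Longrightarrow> finite {v \<in> {x..y}. \<not> locally_const f v}"
  unfolding piecewise_const_def by blast

lemma piecewise_const_const: "piecewise_const (\<lambda>_. c)"
  unfolding piecewise_const_def by (simp add: locally_const_const)

lemma piecewise_const_comp2:
  assumes "piecewise_const f" "piecewise_const g"
  shows "piecewise_const (\<lambda>w. h (f w) (g w))"
  unfolding piecewise_const_def
proof (intro allI)
  fix x y
  show "finite {v \<in> {x..y}. \<not> locally_const (\<lambda>w. h (f w) (g w)) v}"
    by (rule finite_subset[OF _ finite_UnI[OF piecewise_const_finite[OF assms(1), of x y]
          piecewise_const_finite[OF assms(2), of x y]]])
      (use locally_const_comp2 in blast)
qed

lemma piecewise_const_comp:
  assumes "piecewise_const f"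
  shows "piecewise_const (\<lambda>w. h (f w))"
  using piecewise_const_comp2[OF assms assms, of "\<lambda>a _. h a"] .

lemma piecewise_const_shift:
  assumes "piecewise_const f"
  shows "piecewise_const (\<lambda>w. f (w + d))"
  unfolding piecewise_const_def
proof (intro allI)
  fix x y
  have "{v \<in> {x..y}. \<not> locally_const (\<lambda>w. f (w + d)) v}
      \<subseteq> (\<lambda>v. v - d) ` {v \<in> {x + d..y + d}. \<not> locally_const f v}"
  proof
    fix v assume "v \<in> {v \<in> {x..y}. \<not> locally_const (\<lambda>w. f (w + d)) v}"
    then show "v \<in> (\<lambda>v. v - d) ` {v \<in> {x + d..y + d}. \<not> locally_const f v}"
      by (intro image_eqI[where x = "v + d"]) (auto intro: locally_const_shift)
  qed
  then show "finite {v \<in> {x..y}. \<not> locally_const (\<lambda>w. f (w + d)) v}"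
    using piecewise_const_finite[OF assms] finite_surj by blast
qed

lemma finite_frac_in:
  assumes "finite (K :: real set)"
  shows "finite {v \<in> {x..y}. frac v \<in> K}"
proof (rule finite_subset)
  show "{v \<in> {x..y}. frac v \<in> K} \<subseteq> (\<lambda>(k, n). k + of_int n) ` (K \<times> {\<lfloor>x\<rfloor>..\<lfloor>y\<rfloor>})"
  proof
    fix v assume "v \<in> {v \<in> {x..y}. frac v \<in> K}"
    then show "v \<in> (\<lambda>(k, n). k + of_int n) ` (K \<times> {\<lfloor>x\<rfloor>..\<lfloor>y\<rfloor>})"
      by (intro image_eqI[where x = "(frac v, \<lfloor>v\<rfloor>)"]) (auto intro: floor_mono simp: frac_def)
  qed
qed (use assms in auto)

lemma piecewise_constI_frac:
  assumes "finite K" "\<And>v. frac v \<notin> K \<Longrightarrow> locally_const f v"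
  shows "piecewise_const f"
  unfolding piecewise_const_def
  by (intro allI finite_subset[OF _ finite_frac_in[OF assms(1)]]) (use assms(2) in blast)

lemma piecewise_const_floor: "piecewise_const floor"
  by (rule piecewise_constI_frac[of "{0}"]) (auto intro: locally_const_floor)

lemma piecewise_const_frac_in:
  assumes "{c<..<d} \<subseteq> I" "I \<subseteq> {c..d}"
  shows "piecewise_const (\<lambda>v. frac v \<in> I)"
\<comment> \<open>Membership can change only at integers, where \<open>frac\<close> jumps, or at an
  endpoint; elsewhere \<open>frac w\<close> stays on a definite side of \<open>c\<close> and
  \<open>d\<close> for \<open>w\<close> near \<open>v\<close>.\<close>
proof (rule piecewise_constI_frac[of "{0, c, d}"])
  fix v :: real
  assume v: "frac v \<notin> {0, c, d}"
  then have "v \<notin> \<int>" by simp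
  have tf: "(frac \<longlongrightarrow> frac v) (nhds v)"
    using continuous_frac[OF \<open>v \<notin> \<int>\<close>] by (simp add: isCont_def tendsto_at_iff_tendsto_nhds)
  have "\<forall>\<^sub>F w in nhds v. frac w \<in> (if x < c then {..<c} else if x > d then {d<..} else {c<..<d})"
    if "x = frac v" for x
    by (rule topological_tendstoD[OF tf]) (use v that in auto)
  then have "\<forall>\<^sub>F w in nhds v. (frac w \<in> I) = (frac v \<in> I)"
    using assms v by (auto elim!: eventually_mono split: if_splits)
  then show "locally_const (\<lambda>v. frac v \<in> I) v"
    unfolding locally_const_def .
qed simp

lemma piecewise_const_frac_in_Union:
  assumes "finite \<I>" "\<And>I. I \<in> \<I> \<Longrightarrow> piecewise_const (\<lambda>v. frac v \<in> I)"
  shows "piecewise_const (\<lambda>v. frac v \<in> \<Union>\<I>)"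
  using assms
proof (induction \<I> rule: finite_induct)
  case empty
  then show ?case by (simp add: piecewise_const_const)
next
  case (insert I \<I>)
  then have "piecewise_const (\<lambda>v. frac v \<in> I \<or> frac v \<in> \<Union>\<I>)"
    by (intro piecewise_const_comp2[of _ _ "(\<or>)"]) auto
  then show ?case by simp
qed

lemma piecewise_const_interval:
  assumes "x < y" "\<And>v. x < v \<Longrightarrow> v < y \<Longrightarrow> locally_const f v"
  obtains c where "\<And>v. x < v \<Longrightarrow> v < y \<Longrightarrow> f v = c"
proof -
  have "f constant_on {x<..<y}"
  proof (rule locally_constant_imp_constant)
    show "connected {x<..<y}" by simp
    fix v assume v: "v \<in> {x<..<y}"
    then have "locally_const f v" using assms by simp
    then show "\<exists>T. openin (top_of_set {x<..<y}) T \<and> v \<in> T \<and> (\<forall>w\<in>T. f w = f v)"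
      unfolding locally_const_def eventually_nhds using v
      by (metis IntE IntI openin_open_Int)
  qed
  then show ?thesis using that by (auto simp: constant_on_def)
qed

section \<open>Cocycles of finite maps over an irrational rotation\<close>

text \<open>Density of the orbit gives a hitting time for each target, but not a common bound. The
  bound comes from a finite net of spacing \<open>1 / M\<close> on the circle: each net point is
  approximated within \<open>\<epsilon> / 2\<close> by some multiple of \<alpha>, and
  \<open>L\<close> is the largest multiplier used.\<close>

lemma rotation_hits_interval:
  fixes \<alpha> :: real
  assumes "\<alpha> \<notin> \<rat>" "\<epsilon> > 0"
  obtains L where "\<And>v. \<exists>m\<le>L. \<exists>j::int. \<bar>v - real m * \<alpha> - of_int j - x\<bar> < \<epsilon>"
proof -
  obtain M :: nat where M: "M > 0" "1 / real M < \<epsilon> / 2"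
    using real_arch_inverse[of "\<epsilon> / 2"] assms(2) by (metis half_gt_zero inverse_eq_divide not_gr0)
  have "\<exists>m::nat. \<exists>h::int. \<bar>real m * \<alpha> - of_int h - t\<bar> < \<epsilon> / 2" for t
  proof -
    obtain h k where "k > 0" "\<bar>of_int k * \<alpha> - of_int h - t\<bar> < \<epsilon> / 2"
      using sequence_of_fractional_parts_is_dense[OF assms(1), of "\<epsilon> / 2" t]
        half_gt_zero[OF assms(2)] by blast
    then have "\<bar>real (nat k) * \<alpha> - of_int h - t\<bar> < \<epsilon> / 2" by simp
    then show ?thesis by blast
  qed
  then obtain mm hh where mh:
    "\<And>t. \<bar>real (mm t :: nat) * \<alpha> - of_int (hh t :: int) - t\<bar> < \<epsilon> / 2" by metis
  define L where "L = Max ((\<lambda>i. mm (real i / real M)) ` {..M})"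
  have "\<exists>m\<le>L. \<exists>j::int. \<bar>v - real m * \<alpha> - of_int j - x\<bar> < \<epsilon>" for v
  proof -
    define t where "t = frac (v - x)"
    define i where "i = nat \<lfloor>t * M\<rfloor>"
    have t: "0 \<le> t" "t < 1" by (simp_all add: t_def frac_lt_1)
    have i: "real i \<le> t * M" "t * M < real i + 1" unfolding i_def using t by auto
    have "t * M < M" using mult_strict_right_mono[of t 1 "real M"] t M by simp
    then have "i \<le> M" using i by linarith
    then have le: "mm (real i / real M) \<le> L" unfolding L_def by (intro Max_ge) auto
    have "real i / M \<le> t" "t < (real i + 1) / M" using i M by (simp_all add: field_simps)
    then have "\<bar>t - real i / M\<bar> < \<epsilon> / 2" using M(2) by (simp add: add_divide_distrib)
    moreover have "v - x = t + of_int \<lfloor>v - x\<rfloor>" by (simp add: t_def frac_def)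
    ultimately have "\<bar>v - real (mm (real i / M)) * \<alpha>
        - of_int (\<lfloor>v - x\<rfloor> - hh (real i / M)) - x\<bar> < \<epsilon>"
      using mh[of "real i / M"] unfolding of_int_diff by linarith
    then show ?thesis using le by blast
  qed
  then show ?thesis using that by blast
qed

text \<open>The orbit is taken in both directions because arguments go back to earlier heights as
  well as forward. Avoiding integers means that the line meets vertical edges at no vertex.\<close>

definition generic :: "real \<Rightarrow> (real \<Rightarrow> 'a) \<Rightarrow> real \<Rightarrow> bool" where
  "generic \<alpha> f v \<longleftrightarrow> (\<forall>m::int. v + of_int m * \<alpha> \<notin> \<int> \<and> locally_const f (v + of_int m * \<alpha>))"

lemma generic_add_int_mult:
  assumes "generic \<alpha> f v"
  shows "generic \<alpha> f (v + of_int k * \<alpha>)"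
  unfolding generic_def
proof
  fix m :: int
  have "v + of_int k * \<alpha> + of_int m * \<alpha> = v + of_int (k + m) * \<alpha>" by (simp add: algebra_simps)
  then show "v + of_int k * \<alpha> + of_int m * \<alpha> \<notin> \<int> \<and>
      locally_const f (v + of_int k * \<alpha> + of_int m * \<alpha>)"
    using assms unfolding generic_def by metis
qed

lemma generic_shift:
  assumes "generic \<alpha> f v"
  shows "generic \<alpha> f (v + real n * \<alpha>)" "generic \<alpha> f (v - real n * \<alpha>)" "generic \<alpha> f (v - \<alpha>)"
  using generic_add_int_mult[OF assms, of "int n"] generic_add_int_mult[OF assms, of "- int n"]
    generic_add_int_mult[OF assms, of "- 1"] by simp_all

lemma generic_notin_Ints: "generic \<alpha> f v \<Longrightarrow> v + of_int m * \<alpha> \<notin> \<int>"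
  unfolding generic_def by blast

lemma generic_locally_const: "generic \<alpha> f v \<Longrightarrow> locally_const f v"
  unfolding generic_def by (metis add.right_neutral mult_zero_left of_int_0)

lemma generic_add_one:
  assumes "\<And>v. f (v + 1) = f v"
  shows "generic \<alpha> f (v + 1) \<longleftrightarrow> generic \<alpha> f v"
proof -
  have 1: "locally_const f w" if "locally_const f (w + 1)" for w
    using locally_const_shift[OF that] assms by simp
  have 2: "locally_const f (w + 1)" if "locally_const f w" for w
    using locally_const_shift[of f "w + 1" "- 1"] that assms[of "_ - 1"] by simp
  have "v + 1 + of_int m * \<alpha> = (v + of_int m * \<alpha>) + 1" for m :: int by simp
  moreover have "w + 1 \<in> \<int> \<longleftrightarrow> w \<in> \<int>" for w :: real
    by (metis Ints_1 Ints_add Ints_diff add_diff_cancel_right')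
  ultimately show ?thesis unfolding generic_def using 1 2 by metis
qed

lemma generic_comp: "generic \<alpha> f v \<Longrightarrow> generic \<alpha> (\<lambda>w. h (f w)) v"
  unfolding generic_def by (auto intro: locally_const_comp)

lemma countable_not_locally_const:
  assumes "piecewise_const f"
  shows "countable {v. \<not> locally_const f v}"
proof -
  have "{v. \<not> locally_const f v} = (\<Union>n::nat. {v \<in> {- real n..real n}. \<not> locally_const f v})"
    by (auto, metis abs_le_iff minus_le_iff real_arch_simple)
  also have "countable \<dots>"
    using piecewise_const_finite[OF assms] by (intro countable_UN) (auto intro: countable_finite)
  finally show ?thesis .
qed

text \<open>The exceptional set is a union over all integers \<open>m\<close> of translates of one
  countable set.\<close>

lemma countable_not_generic:
  assumes "piecewise_const f"
  shows "countable {v. \<not> generic \<alpha> f v}"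
proof -
  let ?B = "\<int> \<union> {v. \<not> locally_const f v}"
  have "{v. \<not> generic \<alpha> f v} = (\<Union>m::int. (\<lambda>w. w - of_int m * \<alpha>) ` ?B)"
  proof (intro set_eqI iffI)
    fix v assume "v \<in> {v. \<not> generic \<alpha> f v}"
    then obtain m :: int where "v + of_int m * \<alpha> \<in> ?B" unfolding generic_def by blast
    then show "v \<in> (\<Union>m::int. (\<lambda>w. w - of_int m * \<alpha>) ` ?B)"
      by (intro UN_I[of m] rev_image_eqI) auto
  next
    fix v assume "v \<in> (\<Union>m::int. (\<lambda>w. w - of_int m * \<alpha>) ` ?B)"
    then obtain m :: int and w where "v = w - of_int m * \<alpha>" "w \<in> ?B" by blast
    then have "v + of_int m * \<alpha> \<in> ?B" by simp
    then show "v \<in> {v. \<not> generic \<alpha> f v}" unfolding generic_def by blast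
  qed
  also have "countable \<dots>"
    using countable_not_locally_const[OF assms] by (auto simp: Ints_def)
  finally show ?thesis .
qed

lemma generic_dense:
  assumes "piecewise_const f" "x < y"
  obtains v where "x < v" "v < y" "generic \<alpha> f v"
proof -
  have "\<not> {x<..<y} \<subseteq> {v. \<not> generic \<alpha> f v}"
    using countable_subset[OF _ countable_not_generic[OF assms(1)]]
      uncountable_open_interval[of x y] assms(2) by blast
  then show ?thesis using that by auto
qed

lemma periodic_int:
  assumes "\<And>v::real. f (v + 1) = f v"
  shows "f (v + of_int j) = f v"
proof -
  have *: "f (v + real n) = f v" for v n
  proof (induction n)
    case (Suc n)
    have "f (v + real (Suc n)) = f (v + real n + 1)" by (simp add: algebra_simps)
    then show ?case using Suc assms by simp
  qed simp
  show ?thesis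
  proof (cases "j \<ge> 0")
    case True
    then show ?thesis using *[of v "nat j"] by simp
  next
    case False
    then show ?thesis using *[of "v + of_int j" "nat (- j)"] by simp
  qed
qed

lemma periodic_frac:
  assumes "\<And>v::real. f (v + 1) = f v"
  shows "f (frac v) = f v"
  using periodic_int[where f = f, OF assms, of v "- \<lfloor>v\<rfloor>"] by (simp add: frac_def)

lemma generic_frac:
  assumes "\<And>v. f (v + 1) = f v"
  shows "generic \<alpha> f (frac v) \<longleftrightarrow> generic \<alpha> f v"
  using periodic_frac[of "generic \<alpha> f" v] generic_add_one[of f \<alpha>] assms by metis

text \<open>A quantity that cannot increase along the rotation takes its minimum everywhere, after a
  bounded number of steps, since the interval on which the minimum is taken is hit in bounded time.\<close>

lemma minimum_spreads:
  fixes f :: "nat \<Rightarrow> real \<Rightarrow> nat"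
  assumes "\<alpha> \<notin> \<rat>" and g: "piecewise_const g"
    and lc: "\<And>n v. generic \<alpha> g v \<Longrightarrow> locally_const (f n) v"
    and per: "\<And>n v. f n (v + 1) = f n v"
    and step: "\<And>n v. generic \<alpha> g v \<Longrightarrow> f (Suc n) v \<le> f n (v - \<alpha>)"
    and anti: "\<And>n v. f (Suc n) v \<le> f n v"
  obtains N R where "\<And>n v. generic \<alpha> g v \<Longrightarrow> n \<ge> N \<Longrightarrow> f n v = R"
proof -
  define S where "S = {f n v | n v. generic \<alpha> g v}"
  obtain v1 where "generic \<alpha> g v1" using generic_dense[OF g, of 0 1] by auto
  then have "S \<noteq> {}" unfolding S_def by blast
  define R where "R = (LEAST k. k \<in> S)"
  have "R \<in> S" unfolding R_def using \<open>S \<noteq> {}\<close> by (metis LeastI ex_in_conv)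
  then obtain n0 v0 where v0: "f n0 v0 = R" "generic \<alpha> g v0" unfolding S_def by blast
  have min: "R \<le> f n v" if "generic \<alpha> g v" for n v
    unfolding R_def by (rule Least_le) (use that S_def in blast)
  obtain \<epsilon> where e: "\<epsilon> > 0" "\<And>w. \<bar>w - v0\<bar> < \<epsilon> \<Longrightarrow> f n0 w = R"
    using locally_constE[OF lc[OF v0(2)]] v0(1) by metis
  obtain L where L: "\<And>v. \<exists>m\<le>L. \<exists>j::int. \<bar>v - real m * \<alpha> - of_int j - v0\<bar> < \<epsilon>"
    using rotation_hits_interval[OF assms(1) e(1)] by blast
  have steps: "f (n + m) v \<le> f n (v - real m * \<alpha>)" if "generic \<alpha> g v" for n m v
    using that
  proof (induction m arbitrary: v)
    case (Suc m)
    have "f (n + Suc m) v \<le> f (n + m) (v - \<alpha>)" using step[OF Suc.prems] by simp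
    also have "\<dots> \<le> f n (v - \<alpha> - real m * \<alpha>)" using Suc.IH generic_shift(3)[OF Suc.prems] by blast
    finally show ?case by (simp add: algebra_simps)
  qed simp
  have mono: "f n v \<le> f m v" if "m \<le> n" for m n v
    using that lift_Suc_antimono_le[of "\<lambda>n. f n v"] anti by blast
  \<comment> \<open>At time \<open>n0\<close> the minimum is taken on an interval around
    \<open>v0\<close>; at most \<open>L\<close> further steps carry it from there to any generic
    height.\<close>
  have "f n v = R" if v: "generic \<alpha> g v" and n: "n \<ge> n0 + L" for n v
  proof -
    obtain m j where m: "m \<le> L" "\<bar>v - real m * \<alpha> - of_int j - v0\<bar> < \<epsilon>" using L by blast
    have "f n v \<le> f (n0 + m) v" using m n by (intro mono) simp
    also have "\<dots> \<le> f n0 (v - real m * \<alpha>)" by (rule steps[OF v])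
    also have "\<dots> = f n0 (v - real m * \<alpha> + of_int (- j))"
      using periodic_int[of "f n0", OF per] by metis
    also have "\<dots> = R" using m by (intro e) simp
    finally show ?thesis using min[OF v] by (simp add: antisym)
  qed
  from that[OF this] show ?thesis .
qed

section \<open>Nested images and the attractor of a cocycle\<close>

locale rotation_cocycle =
  fixes \<alpha> :: real and \<tau> :: "real \<Rightarrow> 's::finite \<Rightarrow> 's"
  assumes irrational: "\<alpha> \<notin> \<rat>"
    and piecewise: "piecewise_const \<tau>"
    and periodic: "\<tau> (v + 1) = \<tau> v"
begin

primrec iter :: "nat \<Rightarrow> real \<Rightarrow> 's \<Rightarrow> 's" where
  "iter 0 v = id"
| "iter (Suc n) v = \<tau> (v + real n * \<alpha>) \<circ> iter n v"

text \<open>The fibre lies over the end point of the orbits, which start \<open>n\<close> steps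
  earlier (a pullback image). In this form the sets over a fixed height are nested.\<close>

definition image_fibre :: "nat \<Rightarrow> real \<Rightarrow> 's set" where
  "image_fibre n v = range (iter n (v - real n * \<alpha>))"

lemma iter_add: "iter (m + n) v = iter m (v + real n * \<alpha>) \<circ> iter n v"
  by (induction m) (simp_all add: algebra_simps comp_assoc)

lemma iter_periodic: "iter n (v + 1) = iter n v"
proof (induction n)
  case (Suc n)
  have "\<tau> (v + 1 + real n * \<alpha>) = \<tau> (v + real n * \<alpha>)"
    using periodic[of "v + real n * \<alpha>"] by (simp add: algebra_simps)
  then show ?case using Suc by simp
qed simp

lemma iter_frac: "iter n (frac v) = iter n v"
  by (rule periodic_frac) (rule iter_periodic)

lemma piecewise_const_iter: "piecewise_const (iter n)"
proof (induction n)
  case 0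
  then show ?case by (simp add: piecewise_const_const)
next
  case (Suc n)
  show ?case
    using piecewise_const_comp2[OF piecewise_const_shift[OF piecewise, of "real n * \<alpha>"] Suc, of "(\<circ>)"]
    by (simp add: comp_def)
qed

lemma locally_const_iter:
  assumes "generic \<alpha> \<tau> v"
  shows "locally_const (iter n) v"
proof (induction n)
  case 0
  then show ?case by (simp add: locally_const_const)
next
  case (Suc n)
  show ?case
    using locally_const_comp2[OF locally_const_shift[OF
          generic_locally_const[OF generic_shift(1)[OF assms, of n]]] Suc, of "(\<circ>)"]
    by (simp add: comp_def)
qed

lemma image_fibre_0 [simp]: "image_fibre 0 v = UNIV"
  by (simp add: image_fibre_def)

lemma image_fibre_Suc: "image_fibre (Suc n) v = \<tau> (v - \<alpha>) ` image_fibre n (v - \<alpha>)"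
  by (simp add: image_fibre_def algebra_simps image_comp)

lemma iter_in_image_fibre: "iter n v c \<in> image_fibre n (v + real n * \<alpha>)"
  by (simp add: image_fibre_def)

lemma image_fibre_periodic: "image_fibre n (v + 1) = image_fibre n v"
proof -
  have "v + 1 - real n * \<alpha> = (v - real n * \<alpha>) + 1" by simp
  then show ?thesis unfolding image_fibre_def by (metis iter_periodic)
qed

lemma image_fibre_frac: "image_fibre n (frac v) = image_fibre n v"
  by (rule periodic_frac) (rule image_fibre_periodic)

text \<open>One more step in the past only replaces the full set of initial squares by an image of
  it; the last \<open>n\<close> steps are the same.\<close>

lemma image_fibre_Suc_subset: "image_fibre (Suc n) v \<subseteq> image_fibre n v"
proof (induction n arbitrary: v)
  case (Suc n)
  then show ?case using image_fibre_Suc[of "Suc n" v] image_fibre_Suc[of n v] by (simp add: image_mono)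
qed simp

lemma image_fibre_antimono: "m \<le> n \<Longrightarrow> image_fibre n v \<subseteq> image_fibre m v"
  using lift_Suc_antimono_le[of "\<lambda>n. image_fibre n v"] image_fibre_Suc_subset by blast

lemma piecewise_const_image_fibre: "piecewise_const (image_fibre n)"
  using piecewise_const_comp[OF piecewise_const_shift[OF piecewise_const_iter], of range n "- (real n * \<alpha>)"]
  by (simp add: image_fibre_def[abs_def])

lemma locally_const_image_fibre:
  assumes "generic \<alpha> \<tau> v"
  shows "locally_const (image_fibre n) v"
proof -
  have "locally_const (iter n) (v + - (real n * \<alpha>))"
    using locally_const_iter[OF generic_shift(2)[OF assms, of n]] by simp
  from locally_const_comp[OF locally_const_shift[OF this], of range] show ?thesis
    by (simp add: image_fibre_def[abs_def])
qed

text \<open>The cardinality decreases in \<open>n\<close> and along the rotation, so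
  \<open>minimum_spreads\<close> makes it one constant \<open>R\<close>. Nested finite sets of equal
  size coincide, and a map onto a set of the same size is injective.\<close>

lemma image_fibre_stabilizes:
  obtains N where "\<And>n v. generic \<alpha> \<tau> v \<Longrightarrow> n \<ge> N \<Longrightarrow> image_fibre n v = image_fibre N v"
    "\<And>v. generic \<alpha> \<tau> v \<Longrightarrow> inj_on (\<tau> v) (image_fibre N v)"
proof -
  obtain N R where NR: "\<And>n v. generic \<alpha> \<tau> v \<Longrightarrow> n \<ge> N \<Longrightarrow> card (image_fibre n v) = R"
  proof (rule minimum_spreads[of \<alpha> \<tau> "\<lambda>n v. card (image_fibre n v)"])
    show "card (image_fibre (Suc n) v) \<le> card (image_fibre n (v - \<alpha>))" for n v
      by (simp add: image_fibre_Suc card_image_le)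
    show "card (image_fibre (Suc n) v) \<le> card (image_fibre n v)" for n v
      by (simp add: card_mono image_fibre_Suc_subset)
  qed (auto simp: irrational piecewise image_fibre_periodic
      intro: locally_const_comp locally_const_image_fibre)
  have eq: "image_fibre n v = image_fibre N v" if "generic \<alpha> \<tau> v" "n \<ge> N" for n v
    using NR[OF that] NR[OF that(1), of N] image_fibre_antimono[OF that(2)]
    by (intro card_subset_eq) auto
  have "inj_on (\<tau> v) (image_fibre N v)" if "generic \<alpha> \<tau> v" for v
  proof (rule eq_card_imp_inj_on)
    have "generic \<alpha> \<tau> (v + \<alpha>)" using generic_shift(1)[OF that, of 1] by simp
    then have "card (image_fibre (Suc N) (v + \<alpha>)) = R" using NR by simp
    then show "card (\<tau> v ` image_fibre N v) = card (image_fibre N v)"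
      using NR[OF that] by (simp add: image_fibre_Suc)
  qed simp
  from that[OF eq this] show ?thesis .
qed

definition stable_time :: nat where
  "stable_time = (SOME N. (\<forall>n v. generic \<alpha> \<tau> v \<longrightarrow> n \<ge> N \<longrightarrow> image_fibre n v = image_fibre N v) \<and>
    (\<forall>v. generic \<alpha> \<tau> v \<longrightarrow> inj_on (\<tau> v) (image_fibre N v)))"

text \<open>A fixed number of steps defines it at every height, so nesting and periodicity hold
  everywhere; invariance and injectivity are claimed at generic heights only.\<close>

definition attractor :: "real \<Rightarrow> 's set" where
  "attractor = image_fibre stable_time"

lemma
  shows attractor_eq: "generic \<alpha> \<tau> v \<Longrightarrow> n \<ge> stable_time \<Longrightarrow> image_fibre n v = attractor v"
    and inj_on_attractor: "generic \<alpha> \<tau> v \<Longrightarrow> inj_on (\<tau> v) (attractor v)"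
proof -
  have "\<exists>N. (\<forall>n v. generic \<alpha> \<tau> v \<longrightarrow> n \<ge> N \<longrightarrow> image_fibre n v = image_fibre N v) \<and>
    (\<forall>v. generic \<alpha> \<tau> v \<longrightarrow> inj_on (\<tau> v) (image_fibre N v))"
    using image_fibre_stabilizes by metis
  from someI_ex[OF this]
  show "generic \<alpha> \<tau> v \<Longrightarrow> n \<ge> stable_time \<Longrightarrow> image_fibre n v = attractor v"
    "generic \<alpha> \<tau> v \<Longrightarrow> inj_on (\<tau> v) (attractor v)"
    unfolding stable_time_def[symmetric] attractor_def by blast+
qed

lemma image_attractor:
  assumes "generic \<alpha> \<tau> v"
  shows "\<tau> v ` attractor v = attractor (v + \<alpha>)"
proof -
  have "generic \<alpha> \<tau> (v + \<alpha>)" using generic_shift(1)[OF assms, of 1] by simp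
  from attractor_eq[OF this, of "Suc stable_time"] show ?thesis
    by (simp add: image_fibre_Suc attractor_def)
qed

lemma iter_in_attractor:
  assumes "generic \<alpha> \<tau> v" "c \<in> attractor v"
  shows "iter n v c \<in> attractor (v + real n * \<alpha>)"
proof (induction n)
  case (Suc n)
  have "iter (Suc n) v c \<in> \<tau> (v + real n * \<alpha>) ` attractor (v + real n * \<alpha>)"
    using Suc by simp
  also have "\<dots> = attractor (v + real (Suc n) * \<alpha>)"
    using image_attractor[OF generic_shift(1)[OF assms(1), of n]] by (simp add: algebra_simps)
  finally show ?case .
qed (use assms in simp)

lemma attractor_periodic: "attractor (v + 1) = attractor v"
  by (simp add: attractor_def image_fibre_periodic)

lemma attractor_frac: "attractor (frac v) = attractor v"
  by (simp add: attractor_def image_fibre_frac)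

lemma piecewise_const_attractor: "piecewise_const attractor"
  by (simp add: attractor_def piecewise_const_image_fibre)

lemma locally_const_attractor: "generic \<alpha> \<tau> v \<Longrightarrow> locally_const attractor v"
  by (simp add: attractor_def locally_const_image_fibre)

text \<open>These are the squares over \<open>v\<close> reached from \<open>E\<close> in at most
  \<open>n\<close> steps. The recursion strips off the last step, again with the end point
  fixed.\<close>

primrec hits :: "(real \<Rightarrow> 's set) \<Rightarrow> nat \<Rightarrow> real \<Rightarrow> 's set" where
  "hits E 0 v = E v"
| "hits E (Suc n) v = E v \<union> \<tau> (v - \<alpha>) ` hits E n (v - \<alpha>)"

lemma hits_iter:
  "s \<in> hits E n v \<Longrightarrow> \<exists>k s'. s' \<in> E (v - real k * \<alpha>) \<and> iter k (v - real k * \<alpha>) s' = s"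
proof (induction n arbitrary: s v)
  case 0
  then show ?case by (intro exI[of _ "0::nat"]) simp
next
  case (Suc n)
  then consider "s \<in> E v" | s1 where "s1 \<in> hits E n (v - \<alpha>)" "s = \<tau> (v - \<alpha>) s1" by auto
  then show ?case
  proof cases
    case 1
    then show ?thesis by (intro exI[of _ "0::nat"]) simp
  next
    case 2
    from Suc.IH[OF 2(1)] obtain k s' where
      "s' \<in> E (v - \<alpha> - real k * \<alpha>)" "iter k (v - \<alpha> - real k * \<alpha>) s' = s1" by blast
    then show ?thesis using 2(2)
      by (intro exI[of _ "Suc k"] exI[of _ s']) (simp add: algebra_simps)
  qed
qed

lemma hits_Suc_mono: "hits E n v \<subseteq> hits E (Suc n) v"
proof (induction n arbitrary: v)
  case (Suc n)
  show ?case using image_mono[OF Suc[of "v - \<alpha>"], of "\<tau> (v - \<alpha>)"] by auto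
qed simp

text \<open>Poincare recurrence without measure: the part of a fibre of the attractor that is reached from
  the target has the same number of elements in every fibre, so it is carried onto the part in the
  next fibre, which contains the target there.\<close>

theorem recurrence:
  fixes E :: "real \<Rightarrow> 's set"
  defines "g \<equiv> \<lambda>v. (\<tau> v, E v)"
  assumes E: "piecewise_const E" "\<And>v. E (v + 1) = E v" "\<And>v. E v \<subseteq> attractor v"
    and v: "generic \<alpha> g v" and s: "s \<in> E v"
  obtains k s' where "k \<ge> 1" "s' \<in> E (v - real k * \<alpha>)" "iter k (v - real k * \<alpha>) s' = s"
proof -
  have gen: "generic \<alpha> \<tau> w" if "generic \<alpha> g w" for w
    using generic_comp[OF that, of fst] by (simp add: g_def)
  have lcE: "locally_const E w" if "generic \<alpha> g w" for w
    using locally_const_comp[OF generic_locally_const[OF that], of snd] by (simp add: g_def)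
  have sub: "hits E n w \<subseteq> attractor w" if "generic \<alpha> g w" for n w
    using that
  proof (induction n arbitrary: w)
    case (Suc n)
    have "\<tau> (w - \<alpha>) ` hits E n (w - \<alpha>) \<subseteq> \<tau> (w - \<alpha>) ` attractor (w - \<alpha>)"
      using Suc generic_shift(3) by blast
    also have "\<dots> = attractor w"
      using image_attractor[OF gen[OF generic_shift(3)[OF Suc.prems]]] by simp
    finally show ?case using E(3) by simp
  qed (use E(3) in simp)
  have card: "card (\<tau> (w - \<alpha>) ` hits E n (w - \<alpha>)) = card (hits E n (w - \<alpha>))"
    if "generic \<alpha> g w" for n w
    using inj_on_attractor[OF gen[OF generic_shift(3)[OF that]]] sub[OF generic_shift(3)[OF that]]
    by (meson card_image inj_on_subset)
  \<comment> \<open>The reached squares grow in number, so the complementary count is what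
    decreases, as \<open>minimum_spreads\<close> requires.\<close>
  obtain N R where NR: "\<And>n w. generic \<alpha> g w \<Longrightarrow> n \<ge> N \<Longrightarrow> CARD('s) - card (hits E n w) = R"
  proof (rule minimum_spreads[of \<alpha> g "\<lambda>n w. CARD('s) - card (hits E n w)"])
    show "piecewise_const g"
      unfolding g_def by (rule piecewise_const_comp2[OF piecewise E(1)])
    show "locally_const (\<lambda>w. CARD('s) - card (hits E n w)) w" if "generic \<alpha> g w" for n w
    proof -
      have "locally_const (hits E n) w"
        using that
      proof (induction n arbitrary: w)
        case 0
        then show ?case using lcE by simp
      next
        case (Suc n)
        note g' = generic_shift(3)[OF Suc.prems]
        have 1: "locally_const (\<lambda>w. \<tau> (w - \<alpha>)) w"
          using locally_const_shift[of \<tau> w "- \<alpha>"] generic_locally_const[OF gen[OF g']] by simp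
        have "locally_const (\<lambda>w. hits E n (w - \<alpha>)) w"
          using locally_const_shift[of "hits E n" w "- \<alpha>"] Suc.IH[OF g'] by simp
        from locally_const_comp2[OF lcE[OF Suc.prems] locally_const_comp2[OF 1 this, of image], of "(\<union>)"]
        show ?case by simp
      qed
      then show ?thesis by (rule locally_const_comp)
    qed
    show "CARD('s) - card (hits E n (w + 1)) = CARD('s) - card (hits E n w)" for n w
    proof -
      have "hits E n (w + 1) = hits E n w"
      proof (induction n arbitrary: w)
        case (Suc n)
        show ?case using Suc[of "w - \<alpha>"] E(2)[of w] periodic[of "w - \<alpha>"]
          by (simp add: algebra_simps)
      qed (simp add: E(2))
      then show ?thesis by simp
    qed
    show "CARD('s) - card (hits E (Suc n) w) \<le> CARD('s) - card (hits E n (w - \<alpha>))"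
      if "generic \<alpha> g w" for n w
      using card[OF that, of n] by (intro diff_le_mono2) (simp, metis card_mono finite sup_ge2)
    show "CARD('s) - card (hits E (Suc n) w) \<le> CARD('s) - card (hits E n w)" for n w
      by (intro diff_le_mono2 card_mono hits_Suc_mono) simp
  qed (auto simp: irrational)
  \<comment> \<open>Both complementary counts equal \<open>R\<close>; since no cardinality exceeds
    that of the type, the truncated differences can be cancelled.\<close>
  have "card (hits E (Suc N) v) = card (hits E N (v - \<alpha>))"
    using NR[OF v, of "Suc N"] NR[OF generic_shift(3)[OF v], of N]
      card_mono[OF finite, of "hits E (Suc N) v" UNIV] card_mono[OF finite, of "hits E N (v - \<alpha>)" UNIV]
    by simp
  then have "\<tau> (v - \<alpha>) ` hits E N (v - \<alpha>) = hits E (Suc N) v"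
    using card[OF v] by (intro card_subset_eq) auto
  \<comment> \<open>The target over \<open>v\<close> is contained in
    \<open>hits E (Suc N) v\<close>, hence in an image of squares already reached. This last step
    makes the return time positive.\<close>
  then have "s \<in> \<tau> (v - \<alpha>) ` hits E N (v - \<alpha>)" using s by auto
  then obtain s1 where s1: "s1 \<in> hits E N (v - \<alpha>)" "s = \<tau> (v - \<alpha>) s1" by blast
  obtain k s' where "s' \<in> E (v - \<alpha> - real k * \<alpha>)" "iter k (v - \<alpha> - real k * \<alpha>) s' = s1"
    using hits_iter[OF s1(1)] by blast
  then show ?thesis using s1(2) by (intro that[of "Suc k" s']) (simp_all add: algebra_simps)
qed

end

section \<open>Flow lines as orbits of a cocycle\<close>


locale edge_flow =
  fixes r u :: "'s::finite \<Rightarrow> 's" and \<alpha> :: real and e :: "'s \<Rightarrow> real \<Rightarrow> 's"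
  assumes irrational_slope: "\<alpha> \<notin> \<rat>" and slope_pos: "\<alpha> > 0" and bij_u: "bij u"
    and piecewise_e: "piecewise_const (\<lambda>v c. e c (frac v))"
begin

text \<open>Until the next vertical edge the line rises by \<alpha>, so it crosses as many
  horizontal edges as the floor counts: \<open>u\<close> is applied that often, then
  \<open>r\<close>, then the redirection at the new height.\<close>

definition \<tau> :: "real \<Rightarrow> 's \<Rightarrow> 's" where
  "\<tau> v c = e (r ((u ^^ nat \<lfloor>frac v + \<alpha>\<rfloor>) c)) (frac (v + \<alpha>))"

sublocale rotation_cocycle \<alpha> \<tau>
proof
  \<comment> \<open>The number of crossed edges is a difference of two floors, each locally constant
    off a discrete set.\<close>
  have "piecewise_const (\<lambda>v. \<lfloor>v + \<alpha>\<rfloor> - \<lfloor>v\<rfloor>)"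
    using piecewise_const_comp2[OF piecewise_const_shift[OF piecewise_const_floor] piecewise_const_floor] .
  moreover have "\<lfloor>v + \<alpha>\<rfloor> - \<lfloor>v\<rfloor> = \<lfloor>frac v + \<alpha>\<rfloor>" for v
    using floor_diff_of_int[of "v + \<alpha>" "\<lfloor>v\<rfloor>"] by (simp add: frac_def algebra_simps)
  ultimately have 1: "piecewise_const (\<lambda>v. \<lfloor>frac v + \<alpha>\<rfloor>)" by simp
  have 2: "piecewise_const (\<lambda>v c. e c (frac (v + \<alpha>)))"
    using piecewise_const_shift[OF piecewise_e] .
  show "piecewise_const \<tau>"
    using piecewise_const_comp2[OF 1 2, of "\<lambda>k f c. f (r ((u ^^ nat k) c))"]
    by (simp add: \<tau>_def[abs_def])
  show "\<tau> (v + 1) = \<tau> v" for v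
  proof -
    have "v + 1 + \<alpha> = (v + \<alpha>) + 1" by simp
    then show ?thesis unfolding \<tau>_def by (metis frac_1_eq)
  qed
qed (rule irrational_slope)

text \<open>The time that a line of unit speed needs per unit of horizontal distance.\<close>

definition \<kappa> :: real where
  "\<kappa> = sqrt (1 + \<alpha>\<^sup>2)"

lemma kappa_pos: "\<kappa> > 0"
  by (simp add: \<kappa>_def add_pos_nonneg)

text \<open>\<open>q\<close> is the point at horizontal distance \<open>x\<close> on the line that starts from the point \<open>frac v\<close> of
  the left edge of \<open>c\<close>, before it reaches the next vertical edge.\<close>

definition on_line :: "'s \<Rightarrow> real \<Rightarrow> real \<Rightarrow> 's pt \<Rightarrow> bool" where
  "on_line c v x q \<longleftrightarrow> 0 \<le> x \<and> x < 1 \<and>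
     (\<exists>k. q = ((u ^^ k) c, x, frac v + \<alpha> * x - real k) \<and>
        0 \<le> frac v + \<alpha> * x - real k \<and> frac v + \<alpha> * x - real k < 1)"

lemma on_line_frac: "on_line c (frac v) x q \<longleftrightarrow> on_line c v x q"
  by (simp add: on_line_def)

lemma on_lineI:
  assumes "0 \<le> x" "x < 1" "s = (u ^^ k) c" "y = frac v + \<alpha> * x - real k" "0 \<le> y" "y < 1"
  shows "on_line c v x (s, x, y)"
  using assms unfolding on_line_def by blast

lemma on_lineE:
  assumes "on_line c v x q"
  obtains k y where "0 \<le> x" "x < 1" "q = ((u ^^ k) c, x, y)" "y = frac v + \<alpha> * x - real k"
    "0 \<le> y" "y < 1"
  using assms unfolding on_line_def by blast

lemma on_line_left_edge: "on_line c v 0 (c, 0, frac v)"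
  by (rule on_lineI[of _ _ 0]) (simp_all add: frac_lt_1)

lemma on_line_left_edgeD: "on_line c v x (s, 0, y) \<Longrightarrow> x = 0 \<and> s = c \<and> y = frac v"
proof (erule on_lineE)
  fix k y'
  assume *: "(s, 0, y) = ((u ^^ k) c, x, y')" "y' = frac v + \<alpha> * x - real k" "0 \<le> y'" "y' < 1"
  then have "real k < 1" using frac_lt_1[of v] by simp
  then show ?thesis using * by simp
qed

text \<open>The line is followed back to the left edge. Since \<open>y - \<alpha> * x < 1\<close>,
  it crosses \<open>k\<close> horizontal edges downwards with \<open>k\<close> a natural number, and
  surjectivity of \<open>u\<close> provides the square from which it came.\<close>

lemma on_line_exists:
  assumes "0 \<le> x" "x < 1" "0 \<le> y" "y < 1"
  obtains c v where "0 \<le> v" "v < 1" "on_line c v x (s, x, y)" "frac v = frac (y - \<alpha> * x)"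
proof -
  define k where "k = nat (- \<lfloor>y - \<alpha> * x\<rfloor>)"
  have "y - \<alpha> * x < 1" using assms slope_pos by (smt (verit) mult_nonneg_nonneg)
  then have "\<lfloor>y - \<alpha> * x\<rfloor> \<le> 0" by linarith
  then have k: "real k = - of_int \<lfloor>y - \<alpha> * x\<rfloor>" by (simp add: k_def)
  define v where "v = frac (y - \<alpha> * x)"
  have "surj (u ^^ k)" using bij_u by (simp add: bij_is_surj bij_fn)
  then obtain c where c: "s = (u ^^ k) c" by (metis surjD)
  have "on_line c v x (s, x, y)"
    by (rule on_lineI[OF _ _ c]) (use assms k in \<open>simp_all add: v_def frac_def\<close>)
  then show ?thesis using that[of v c] by (simp add: v_def frac_lt_1)
qed

text \<open>Two starting heights for one point differ by an integer, yet both lie in [0, 1). So they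
  agree, the levels agree, and injectivity of a power of \<open>u\<close> recovers the
  square.\<close>

lemma on_line_unique:
  assumes "on_line c v x q" "on_line c' v' x' q"
  shows "x' = x \<and> c' = c \<and> frac v' = frac v"
proof -
  obtain k y where 1: "q = ((u ^^ k) c, x, y)" "y = frac v + \<alpha> * x - real k"
    using assms(1) by (rule on_lineE)
  obtain k' y' where 2: "q = ((u ^^ k') c', x', y')" "y' = frac v' + \<alpha> * x' - real k'"
    using assms(2) by (rule on_lineE)
  have "x' = x" "frac v - frac v' = real_of_int (int k - int k')" using 1 2 by auto
  moreover have "\<bar>frac v - frac v'\<bar> < 1"
    using frac_lt_1[of v] frac_lt_1[of v'] frac_ge_0[of v] frac_ge_0[of v'] by linarith
  ultimately have "int k = int k'" by linarith
  then have "k' = k" by simp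
  moreover have "inj (u ^^ k)" using bij_u by (simp add: bij_is_inj bij_fn)
  ultimately show ?thesis using 1 2 \<open>frac v - frac v' = _\<close> by (simp add: inj_eq)
qed

lemma frac_step:
  assumes "of_int k \<le> frac v + \<alpha>" "frac v + \<alpha> < of_int k + 1"
  shows "\<lfloor>frac v + \<alpha>\<rfloor> = k" "frac (v + \<alpha>) = frac v + \<alpha> - of_int k"
proof -
  show f: "\<lfloor>frac v + \<alpha>\<rfloor> = k" using assms by (rule floor_unique)
  have "frac (v + \<alpha>) = frac (frac v + \<alpha>)"
    using floor_diff_of_int[of "v + \<alpha>" "\<lfloor>v\<rfloor>"] by (simp add: frac_def algebra_simps)
  then show "frac (v + \<alpha>) = frac v + \<alpha> - of_int k" using f by (simp add: frac_def)
qed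

lemma iter_Suc_left: "iter (Suc n) v c = iter n (v + \<alpha>) (\<tau> v c)"
  using iter_add[of n 1 v] by simp

text \<open>This direction holds at all heights: a derivation of \<open>flow\<close> exists only for
  lines that meet no singularity, and each of its rules matches at most one step of the
  cocycle.\<close>

lemma flow_on_line:
  assumes "flow r u \<alpha> e t p q" "on_line c v x p"
  shows "\<exists>n x'. on_line (iter n v c) (v + real n * \<alpha>) x' q \<and> t = (real n + x' - x) * \<kappa>"
  using assms
proof (induction arbitrary: c v x rule: flow.induct)
  case (inside_square s x1 y h)
  obtain k where k: "x = x1" "s = (u ^^ k) c" "y = frac v + \<alpha> * x - real k" "0 \<le> x" "0 \<le> y"
    using inside_square.prems by (auto elim: on_lineE)
  have "0 \<le> \<alpha> * h" using slope_pos inside_square by simp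
  then have "on_line c v (x + h) (s, x + h, y + \<alpha> * h)"
    by (intro on_lineI[of _ _ k]) (use k inside_square in \<open>auto simp: algebra_simps\<close>)
  then show ?case using k by (intro exI[of _ "0::nat"] exI[of _ "x + h"]) (simp add: \<kappa>_def)
next
  case (right_edge s x1 y h t q)
  obtain k where k: "x = x1" "s = (u ^^ k) c" "y = frac v + \<alpha> * x - real k" "0 \<le> x" "0 \<le> y" "x < 1"
    using right_edge.prems by (auto elim: on_lineE)
  have h: "h = 1 - x" using right_edge.hyps k by simp
  have "0 \<le> \<alpha> * h" using slope_pos k by (simp add: h)
  moreover have y': "y + \<alpha> * h = frac v + \<alpha> - real k" using k by (simp add: h algebra_simps)
  ultimately have "of_int (int k) \<le> frac v + \<alpha>" "frac v + \<alpha> < of_int (int k) + 1"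
    using right_edge.hyps k by simp_all
  note fs = frac_step[OF this]
  have "on_line (\<tau> v c) (v + \<alpha>) 0 (e (r s) (y + \<alpha> * h), 0, y + \<alpha> * h)"
    using on_line_left_edge[of "\<tau> v c" "v + \<alpha>"] unfolding y' by (simp add: \<tau>_def k(2) fs)
  from right_edge.IH[OF this] obtain n x' where
    "on_line (iter n (v + \<alpha>) (\<tau> v c)) (v + \<alpha> + real n * \<alpha>) x' q" "t = (real n + x' - 0) * \<kappa>"
    by blast
  then show ?case
    by (intro exI[of _ "Suc n"] exI[of _ x'])
      (simp only: iter_Suc_left, simp add: \<kappa>_def h algebra_simps)
next
  case (top_edge s x1 y h t q)
  obtain k where k: "x = x1" "s = (u ^^ k) c" "y = frac v + \<alpha> * x - real k" "0 \<le> x" "0 \<le> y" "y < 1"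
    using top_edge.prems by (auto elim: on_lineE)
  have "\<alpha> * h > 0" using k top_edge.hyps by linarith
  then have "h > 0" using slope_pos by (simp add: zero_less_mult_iff)
  have "on_line c v (x + h) (u s, x + h, 0)"
    by (rule on_lineI[of _ _ "Suc k"]) (use k top_edge.hyps \<open>h > 0\<close> in \<open>auto simp: algebra_simps\<close>)
  from top_edge.IH[OF this[unfolded k(1)]] obtain n x' where
    "on_line (iter n v c) (v + real n * \<alpha>) x' q" "t = (real n + x' - (x + h)) * \<kappa>"
    using k(1) by blast
  then show ?case by (intro exI[of _ n] exI[of _ x']) (simp add: \<kappa>_def algebra_simps)
next
  case (regular_vertex s x1 y h t q)
  obtain k where k: "x = x1" "s = (u ^^ k) c" "y = frac v + \<alpha> * x - real k" "0 \<le> x" "0 \<le> y" "x < 1"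
    using regular_vertex.prems by (auto elim: on_lineE)
  have h: "h = 1 - x" using regular_vertex.hyps k by simp
  \<comment> \<open>Arriving exactly at a vertex, the floor counts the top edge as crossed. So the
    cocycle goes up before it goes right, in agreement with the square \<open>r (u s)\<close> of the
    rule.\<close>
  have y': "frac v + \<alpha> = real (Suc k)" using k regular_vertex.hyps by (simp add: h algebra_simps)
  have "of_int (int (Suc k)) \<le> frac v + \<alpha>" "frac v + \<alpha> < of_int (int (Suc k)) + 1"
    using y' by simp_all
  note fs = frac_step[OF this]
  have f0: "frac (v + \<alpha>) = 0" using fs(2) y' by simp
  have \<tau>: "\<tau> v c = e (r (u s)) 0" unfolding \<tau>_def fs(1) f0 nat_int by (simp add: k(2))
  have "on_line (\<tau> v c) (v + \<alpha>) 0 (e (r (u s)) 0, 0, 0)"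
    using on_line_left_edge[of "\<tau> v c" "v + \<alpha>"] by (simp only: \<tau> f0)
  from regular_vertex.IH[OF this] obtain n x' where
    "on_line (iter n (v + \<alpha>) (\<tau> v c)) (v + \<alpha> + real n * \<alpha>) x' q" "t = (real n + x' - 0) * \<kappa>"
    by blast
  then show ?case
    by (intro exI[of _ "Suc n"] exI[of _ x'])
      (simp only: iter_Suc_left, simp add: \<kappa>_def h algebra_simps)
qed

section \<open>Existence of flow lines that avoid the vertices\<close>

lemma start_pt_on_line:
  assumes "0 \<le> x" "x < 1" "0 \<le> frac v + \<alpha> * x - real k" "frac v + \<alpha> * x - real k < 1" "v \<notin> \<int>"
  shows "start_pt r u s x (frac v + \<alpha> * x - real k)"
proof -
  have "frac v \<noteq> real k"
  proof
    assume "frac v = real k"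
    then have "k = 0" using frac_lt_1[of v] by simp
    then show False using \<open>frac v = real k\<close> assms(5) by simp
  qed
  then show ?thesis using assms unfolding start_pt_def by auto
qed

lemma flow_through_top:
  assumes "v \<notin> \<int>" "0 \<le> x" "0 \<le> frac v + \<alpha> * x - real k" "frac v + \<alpha> * x - real k < 1"
    and "x1 < 1" "frac v + \<alpha> * x1 = real k + 1"
    and "flow r u \<alpha> e t ((u ^^ Suc k) c, x1, 0) q"
  shows "flow r u \<alpha> e ((x1 - x) * \<kappa> + t) ((u ^^ k) c, x, frac v + \<alpha> * x - real k) q"
    and "x < x1"
proof -
  have "\<alpha> * x < \<alpha> * x1" using assms by linarith
  then show "x < x1" using slope_pos by simp
  then have "start_pt r u ((u ^^ k) c) x (frac v + \<alpha> * x - real k)"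
    using assms by (intro start_pt_on_line) auto
  then show "flow r u \<alpha> e ((x1 - x) * \<kappa> + t) ((u ^^ k) c, x, frac v + \<alpha> * x - real k) q"
    unfolding \<kappa>_def by (rule flow.top_edge) (use assms in \<open>simp_all add: algebra_simps\<close>)
qed

text \<open>Induction on the number \<open>k' - k\<close> of horizontal edges still to be
  crossed.\<close>

lemma flow_within_strip:
  assumes "v \<notin> \<int>" "on_line c v x p" "on_line c v x' q" "x \<le> x'"
  shows "flow r u \<alpha> e ((x' - x) * \<kappa>) p q"
proof -
  obtain k y where p: "0 \<le> x" "x < 1" "p = ((u ^^ k) c, x, y)" "y = frac v + \<alpha> * x - real k"
    "0 \<le> y" "y < 1" using assms(2) by (rule on_lineE)
  obtain k' y' where q: "0 \<le> x'" "x' < 1" "q = ((u ^^ k') c, x', y')" "y' = frac v + \<alpha> * x' - real k'"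
    "0 \<le> y'" "y' < 1" using assms(3) by (rule on_lineE)
  have "\<alpha> * x \<le> \<alpha> * x'" using assms(4) slope_pos by simp
  then have "real k < real k' + 1" using p q by linarith
  then have "k \<le> k'" by linarith
  then have "flow r u \<alpha> e ((x' - x) * \<kappa>) ((u ^^ k) c, x, frac v + \<alpha> * x - real k) q"
    using p assms(4)
  proof (induction "k' - k" arbitrary: k x y p)
    case 0
    then have "k = k'" by simp
    have "start_pt r u ((u ^^ k) c) x (frac v + \<alpha> * x - real k)"
      using 0 assms(1) by (intro start_pt_on_line) auto
    from flow.inside_square[OF this, where h = "x' - x" and \<alpha> = \<alpha> and e = e] 0 q show ?case
      unfolding \<kappa>_def \<open>k = k'\<close> by (simp add: algebra_simps)
  next
    case (Suc j)
    \<comment> \<open>The horizontal coordinate at which the line leaves its present square through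
      the top edge.\<close>
    define x1 where "x1 = (real k + 1 - frac v) / \<alpha>"
    have x1: "frac v + \<alpha> * x1 = real k + 1" using slope_pos by (simp add: x1_def)
    have "real k + 1 \<le> real k'" using Suc.hyps(2) by linarith
    then have "\<alpha> * x1 \<le> \<alpha> * x'" using x1 q by linarith
    then have "x1 \<le> x'" using slope_pos by simp
    have "\<alpha> * x < \<alpha> * x1" using Suc.prems x1 by linarith
    then have "0 \<le> x1" using slope_pos Suc.prems by simp
    have "flow r u \<alpha> e ((x' - x1) * \<kappa>) ((u ^^ Suc k) c, x1, frac v + \<alpha> * x1 - real (Suc k)) q"
      by (rule Suc.hyps(1)[OF _ _ _ _ refl refl]) (use Suc x1 \<open>x1 \<le> x'\<close> \<open>0 \<le> x1\<close> q in auto)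
    then have "flow r u \<alpha> e ((x' - x1) * \<kappa>) ((u ^^ Suc k) c, x1, 0) q" using x1 by simp
    from flow_through_top(1)[OF assms(1) _ _ _ _ x1 this, of x] Suc.prems q \<open>x1 \<le> x'\<close>
    show ?case by (simp add: algebra_simps)
  qed
  then show ?thesis using p by simp
qed

text \<open>The same induction, ending at the right edge. Since \<open>v + \<alpha>\<close> is not
  an integer, the arrival height is positive, so every top edge is crossed strictly before the
  vertical edge and no corner is met.\<close>

lemma flow_to_next_strip:
  assumes "v \<notin> \<int>" "v + \<alpha> \<notin> \<int>" "on_line c v x p"
    and "flow r u \<alpha> e t (\<tau> v c, 0, frac (v + \<alpha>)) q"
  shows "flow r u \<alpha> e ((1 - x) * \<kappa> + t) p q"
proof -
  obtain k y where p: "0 \<le> x" "x < 1" "p = ((u ^^ k) c, x, y)" "y = frac v + \<alpha> * x - real k"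
    "0 \<le> y" "y < 1" using assms(3) by (rule on_lineE)
  define k' where "k' = nat \<lfloor>frac v + \<alpha>\<rfloor>"
  have "0 \<le> frac v + \<alpha>" using slope_pos frac_ge_0[of v] by linarith
  then have fl: "\<lfloor>frac v + \<alpha>\<rfloor> = int k'" by (simp add: k'_def)
  have fr: "frac (v + \<alpha>) = frac v + \<alpha> - real k'"
    using frac_step(2)[of "int k'"] fl floor_correct[of "frac v + \<alpha>"] by simp
  have "frac (v + \<alpha>) > 0" using assms(2) frac_gt_0_iff by blast
  have "\<alpha> * x \<le> \<alpha>" using p slope_pos by simp
  then have "real k < real k' + 1" using p fr frac_lt_1[of "v + \<alpha>"] by linarith
  then have "k \<le> k'" by linarith
  then have "flow r u \<alpha> e ((1 - x) * \<kappa> + t) ((u ^^ k) c, x, frac v + \<alpha> * x - real k) q"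
    using p
  proof (induction "k' - k" arbitrary: k x y p)
    case 0
    then have "k = k'" by simp
    have st: "start_pt r u ((u ^^ k) c) x (frac v + \<alpha> * x - real k)"
      using 0 assms(1) by (intro start_pt_on_line) auto
    have y: "frac v + \<alpha> * x - real k' + \<alpha> * (1 - x) = frac (v + \<alpha>)"
      using fr by (simp add: algebra_simps)
    show ?case unfolding \<kappa>_def
      by (rule flow.right_edge[OF st]) (use assms(4) \<open>k = k'\<close> in \<open>simp_all add: y frac_lt_1 \<tau>_def fl\<close>)
  next
    case (Suc j)
    define x1 where "x1 = (real k + 1 - frac v) / \<alpha>"
    have x1: "frac v + \<alpha> * x1 = real k + 1" using slope_pos by (simp add: x1_def)
    have "real k + 1 \<le> real k'" using Suc.hyps(2) by linarith
    then have "\<alpha> * x1 < \<alpha> * 1" using x1 fr \<open>frac (v + \<alpha>) > 0\<close> by linarith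
    then have "x1 < 1" using slope_pos by simp
    have "\<alpha> * x < \<alpha> * x1" using Suc.prems x1 by linarith
    then have "0 \<le> x1" using slope_pos Suc.prems by simp
    have "flow r u \<alpha> e ((1 - x1) * \<kappa> + t) ((u ^^ Suc k) c, x1, frac v + \<alpha> * x1 - real (Suc k)) q"
      by (rule Suc.hyps(1)[OF _ _ _ _ refl refl]) (use Suc x1 \<open>x1 < 1\<close> \<open>0 \<le> x1\<close> in auto)
    then have "flow r u \<alpha> e ((1 - x1) * \<kappa> + t) ((u ^^ Suc k) c, x1, 0) q" using x1 by simp
    from flow_through_top(1)[OF assms(1) _ _ _ \<open>x1 < 1\<close> x1 this, of x] Suc.prems
    show ?case by (simp add: algebra_simps)
  qed
  then show ?thesis using p by simp
qed

text \<open>Converse of \<open>flow_on_line\<close> at generic heights: orbits of the cocycle are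
  realized by flow lines, one vertical edge at a time.\<close>

lemma flow_exists:
  assumes "generic \<alpha> g v" "on_line c v x p" "on_line (iter n v c) (v + real n * \<alpha>) x' q"
    and "x \<le> real n + x'"
  shows "flow r u \<alpha> e ((real n + x' - x) * \<kappa>) p q"
  using assms
proof (induction n arbitrary: c v x p)
  case 0
  then show ?case
    using flow_within_strip[of v c x p x' q] generic_notin_Ints[OF 0(1), of 0] by simp
next
  case (Suc n)
  have x': "0 \<le> x'" using Suc.prems(3) by (rule on_lineE)
  have g: "generic \<alpha> g (v + \<alpha>)" using generic_shift(1)[OF Suc.prems(1), of 1] by simp
  have "on_line (iter n (v + \<alpha>) (\<tau> v c)) (v + \<alpha> + real n * \<alpha>) x' q"
    using Suc.prems(3) unfolding iter_Suc_left by (simp add: algebra_simps)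
  from Suc.IH[OF g on_line_left_edge this] x'
  have "flow r u \<alpha> e ((real n + x') * \<kappa>) (\<tau> v c, 0, frac (v + \<alpha>)) q" by simp
  from flow_to_next_strip[OF _ _ Suc.prems(2) this]
    generic_notin_Ints[OF Suc.prems(1), of 0] generic_notin_Ints[OF Suc.prems(1), of 1]
  show ?case by (simp add: algebra_simps)
qed

lemma flow_start_pt: "flow r u \<alpha> e t (s, x, y) q \<Longrightarrow> start_pt r u s x y"
  by (erule flow.cases) auto

end

section \<open>Termination of the extension process\<close>

lemma frac_frac_add: "frac (frac v + d) = frac (v + d :: real)"
  using floor_diff_of_int[of "v + d" "\<lfloor>v\<rfloor>"] by (simp add: frac_def algebra_simps)

context rotation_cocycle
begin

lemma cocycle_frac: "\<tau> (frac v) = \<tau> v"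
  by (rule periodic_frac) (rule periodic)

lemma iter_in_image_fibre_add:
  assumes "c \<in> image_fibre m v"
  shows "iter n v c \<in> image_fibre (m + n) (v + real n * \<alpha>)"
proof -
  obtain c0 where "c = iter m (v - real m * \<alpha>) c0"
    using assms unfolding image_fibre_def by blast
  then have "iter n v c = iter (n + m) (v - real m * \<alpha>) c0" by (simp add: iter_add)
  moreover have "v - real m * \<alpha> = v + real n * \<alpha> - real (m + n) * \<alpha>" by (simp add: algebra_simps)
  ultimately show ?thesis unfolding image_fibre_def by (simp add: add.commute)
qed

end

locale barrier =
  fixes r u :: "'s::finite \<Rightarrow> 's" and \<alpha> :: real and a b :: 's and J :: "real set"
  assumes irrational: "\<alpha> \<notin> \<rat>" and pos: "\<alpha> > 0" and bij_u: "bij u" and distinct: "a \<noteq> b"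
    and piecewise_J: "piecewise_const (\<lambda>v. frac v \<in> J)" and J_subset: "J \<subseteq> {0..<1}"
begin

sublocale G: edge_flow r u \<alpha> "\<lambda>c y. c"
  by unfold_locales (simp_all add: irrational pos bij_u piecewise_const_const)

sublocale D: edge_flow r u \<alpha> "\<lambda>c y. if c = b \<and> y \<in> J then a else c"
proof unfold_locales
  show "piecewise_const (\<lambda>v c. if c = b \<and> frac v \<in> J then a else c)"
    using piecewise_const_comp[OF piecewise_J, of "\<lambda>t c. if c = b \<and> t then a else c"] .
qed (simp_all add: irrational pos bij_u)

section \<open>The discretized geodesic flow at nonsingular heights\<close>

abbreviation T :: "(('s \<times> real) \<times> ('s \<times> real)) set" where
  "T \<equiv> next_edge_pt r u \<alpha>"

text \<open>For a constant function local constancy is vacuous, so what remains is that the orbit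
  avoids the integers.\<close>

abbreviation nonsingular :: "real \<Rightarrow> bool" where
  "nonsingular \<equiv> generic \<alpha> (\<lambda>_. ())"

lemma nonsingular_generic: "generic \<alpha> g v \<Longrightarrow> nonsingular v"
  using generic_comp[of \<alpha> g v "\<lambda>_. ()"] .

lemma geodesic_left_edge:
  assumes "geodesic_flow r u \<alpha> t (s, 0, y) (s', 0, y')"
  obtains n where "0 \<le> y" "y < 1" "t = real n * G.\<kappa>" "s' = G.iter n y s" "y' = frac (y + real n * \<alpha>)"
proof -
  have fl: "flow r u \<alpha> (\<lambda>c y. c) t (s, 0, y) (s', 0, y')"
    using assms by (simp add: geodesic_flow_def)
  have y: "0 \<le> y" "y < 1" using G.flow_start_pt[OF fl] by (simp_all add: start_pt_def)
  then have "frac y = y" by (simp add: frac_eq)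
  then have "G.on_line s y 0 (s, 0, y)" using G.on_line_left_edge[of s y] by simp
  from G.flow_on_line[OF fl this] obtain n x' where
    *: "G.on_line (G.iter n y s) (y + real n * \<alpha>) x' (s', 0, y')" "t = (real n + x' - 0) * G.\<kappa>"
    by blast
  from G.on_line_left_edgeD[OF *(1)] *(2) y show ?thesis by (intro that[of n]) simp_all
qed

lemma next_edge_pt_backward:
  assumes "((s, y), (s', y')) \<in> T"
  shows "0 \<le> y \<and> y < 1 \<and> (\<exists>n. y' = frac (y + real n * \<alpha>))"
proof -
  obtain t where "geodesic_flow r u \<alpha> t (s, 0, y) (s', 0, y')"
    using assms unfolding next_edge_pt_def by blast
  then show ?thesis by (rule geodesic_left_edge) blast
qed

text \<open>A line from a left edge is on left edges only at multiples of \<open>G.\<kappa>\<close>,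
  and at a nonsingular height the time \<open>G.\<kappa>\<close> itself occurs, so it is the
  first.\<close>

lemma next_edge_pt_iff:
  assumes "nonsingular y" "0 \<le> y" "y < 1"
  shows "((s, y), z) \<in> T \<longleftrightarrow> z = (G.\<tau> y s, frac (y + \<alpha>))"
proof -
  have y: "frac y = y" using assms by (simp add: frac_eq)
  have "flow r u \<alpha> (\<lambda>c y. c) ((real 1 + 0 - 0) * G.\<kappa>) (s, 0, frac y) (G.\<tau> y s, 0, frac (y + \<alpha>))"
    by (rule G.flow_exists[OF assms(1) G.on_line_left_edge])
      (use G.on_line_left_edge[of "G.\<tau> y s" "y + \<alpha>"] in simp_all)
  then have first: "geodesic_flow r u \<alpha> G.\<kappa> (s, 0, y) (G.\<tau> y s, 0, frac (y + \<alpha>))"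
    by (simp add: geodesic_flow_def y)
  show ?thesis
  proof
    assume *: "((s, y), z) \<in> T"
    obtain s' y' where z: "z = (s', y')" by (cases z)
    obtain t where t: "t > 0" "geodesic_flow r u \<alpha> t (s, 0, y) (s', 0, y')"
      "\<And>t' s'' y''. 0 < t' \<Longrightarrow> t' < t \<Longrightarrow> \<not> geodesic_flow r u \<alpha> t' (s, 0, y) (s'', 0, y'')"
      using * unfolding next_edge_pt_def z by blast
    obtain n where n: "t = real n * G.\<kappa>" "s' = G.iter n y s" "y' = frac (y + real n * \<alpha>)"
      using t(2) by (rule geodesic_left_edge)
    have "t \<le> G.\<kappa>" using t(3)[OF G.kappa_pos] first by force
    then have "real n \<le> 1" using G.kappa_pos n(1) by simp
    moreover have "n \<noteq> 0" using t(1) n(1) by (intro notI) simp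
    ultimately have "n = 1" by linarith
    then show "z = (G.\<tau> y s, frac (y + \<alpha>))" using n z by simp
  next
    assume z: "z = (G.\<tau> y s, frac (y + \<alpha>))"
    have "\<not> geodesic_flow r u \<alpha> t' (s, 0, y) (s'', 0, y'')" if "0 < t'" "t' < G.\<kappa>" for t' s'' y''
    proof
      assume "geodesic_flow r u \<alpha> t' (s, 0, y) (s'', 0, y'')"
      then obtain n where "t' = real n * G.\<kappa>" by (rule geodesic_left_edge)
      then have "0 < real n" "real n < 1" using that G.kappa_pos by (auto intro: zero_less_mult_pos2)
      then show False by simp
    qed
    then show "((s, y), z) \<in> T" unfolding next_edge_pt_def z using first G.kappa_pos by blast
  qed
qed

lemma next_edge_pt_relpow_iff:
  assumes "nonsingular y" "0 \<le> y" "y < 1"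
  shows "((s, y), z) \<in> T ^^ n \<longleftrightarrow> z = (G.iter n y s, frac (y + real n * \<alpha>))"
proof (induction n arbitrary: z)
  case 0
  have "frac y = y" using assms by (simp add: frac_eq)
  then show ?case by auto
next
  case (Suc n)
  let ?y = "frac (y + real n * \<alpha>)"
  have "nonsingular ?y" using generic_shift(1)[OF assms(1)] by (simp add: generic_frac)
  then have "((G.iter n y s, ?y), z) \<in> T \<longleftrightarrow> z = (G.\<tau> ?y (G.iter n y s), frac (?y + \<alpha>))"
    by (rule next_edge_pt_iff) (simp_all add: frac_lt_1)
  moreover have "((s, y), z) \<in> T ^^ Suc n \<longleftrightarrow> ((G.iter n y s, ?y), z) \<in> T"
    using Suc by (auto simp: relcomp_unfold)
  ultimately show ?case by (simp add: G.cocycle_frac frac_frac_add algebra_simps)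
qed

text \<open>The sets \<open>A_seq\<close> are examined from their end points, where genericity is
  assumed. It passes to the starting points because each step of \<open>T\<close>, defined or not
  elsewhere, adds a multiple of \<alpha> modulo 1.\<close>

lemma next_edge_pt_relpow_backward:
  assumes "\<And>v. f (v + 1) = f v" "(x, (s', y')) \<in> T ^^ n" "generic \<alpha> f y'"
  shows "generic \<alpha> f (snd x)"
  using assms(2,3)
proof (induction n arbitrary: s' y')
  case (Suc n)
  then obtain s1 y1 where 1: "(x, (s1, y1)) \<in> T ^^ n" "((s1, y1), (s', y')) \<in> T"
    by (auto simp: relcomp_unfold)
  then obtain m where "y' = frac (y1 + real m * \<alpha>)" using next_edge_pt_backward by blast
  then have "generic \<alpha> f (y1 + real m * \<alpha>)" using Suc.prems(2) generic_frac[of f, OF assms(1)] by simp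
  then have "generic \<alpha> f y1" using generic_shift(2)[of \<alpha> f "y1 + real m * \<alpha>" m] by simp
  then show ?case using Suc.IH 1(1) by blast
qed auto

section \<open>Comparison of geodesic and dissipative orbits\<close>

lemma dissipative_step: "D.\<tau> v c = (if G.\<tau> v c = b \<and> frac (v + \<alpha>) \<in> J then a else G.\<tau> v c)"
  by (simp add: D.\<tau>_def G.\<tau>_def)

text \<open>Hitting the union of \<open>A\<close> and \<open>B\<close> geodesically is the same as
  arriving on \<open>A\<close> dissipatively; this turns the first return map into a statement about
  \<open>D\<close>.\<close>

lemma dissipative_step_iff:
  "frac (v + \<alpha>) \<in> J \<Longrightarrow> D.\<tau> v c = a \<longleftrightarrow> G.\<tau> v c = a \<or> G.\<tau> v c = b"
  by (simp add: dissipative_step)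

lemma dissipative_step_not_b: "frac (v + \<alpha>) \<in> J \<Longrightarrow> D.\<tau> v c \<noteq> b"
  using distinct by (simp add: dissipative_step)

lemma dissipative_step_eq: "\<not> (G.\<tau> v c = b \<and> frac (v + \<alpha>) \<in> J) \<Longrightarrow> D.\<tau> v c = G.\<tau> v c"
  by (auto simp: dissipative_step)

lemma geodesic_step_eq: "\<not> (D.\<tau> v c = a \<and> frac (v + \<alpha>) \<in> J) \<Longrightarrow> G.\<tau> v c = D.\<tau> v c"
  by (auto simp: dissipative_step)

lemma dissipative_iter_eq:
  assumes "\<And>m. 1 \<le> m \<Longrightarrow> m \<le> n \<Longrightarrow> \<not> (G.iter m v c = b \<and> frac (v + real m * \<alpha>) \<in> J)"
  shows "D.iter n v c = G.iter n v c"
  using assms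
proof (induction n)
  case (Suc n)
  have "D.\<tau> (v + real n * \<alpha>) (G.iter n v c) = G.\<tau> (v + real n * \<alpha>) (G.iter n v c)"
    by (rule dissipative_step_eq) (use Suc.prems[of "Suc n"] in \<open>simp add: algebra_simps\<close>)
  then show ?case using Suc by simp
qed simp

text \<open>Every redirection ends on \<open>A\<close>, so an orbit of \<open>D\<close> that is
  never seen there has not been redirected.\<close>

lemma geodesic_iter_eq:
  assumes "\<And>m. 1 \<le> m \<Longrightarrow> m \<le> n \<Longrightarrow> \<not> (D.iter m v c = a \<and> frac (v + real m * \<alpha>) \<in> J)"
  shows "G.iter n v c = D.iter n v c"
  using assms
proof (induction n)
  case (Suc n)
  have "G.\<tau> (v + real n * \<alpha>) (D.iter n v c) = D.\<tau> (v + real n * \<alpha>) (D.iter n v c)"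
    by (rule geodesic_step_eq) (use Suc.prems[of "Suc n"] in \<open>simp add: algebra_simps\<close>)
  then show ?case using Suc by simp
qed simp

section \<open>The sets of the extension process and the attractor\<close>

lemma A_seq_subset: "A_seq r u \<alpha> a b J i \<subseteq> {a} \<times> J"
  by (cases i) (auto simp: Let_def)

lemma A_seq_Suc_iff:
  "(a, v) \<in> A_seq r u \<alpha> a b J (Suc i) \<longleftrightarrow> (\<exists>w c. (a, w) \<in> A_seq r u \<alpha> a b J i \<and>
     ((a, w), (c, v)) \<in> first_return T ({a} \<times> J \<union> {b} \<times> J))"
    (is "?L \<longleftrightarrow> ?R")
proof
  assume ?L
  then obtain x z where xz: "x \<in> A_seq r u \<alpha> a b J i"
    "(x, z) \<in> first_return T ({a} \<times> J \<union> {b} \<times> J)" "v = snd z"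
    by (auto simp: Let_def)
  moreover have "x = (a, snd x)" using xz(1) A_seq_subset[of i] by (cases x) auto
  ultimately show ?R by (metis prod.collapse)
next
  assume ?R
  then obtain w c where 1: "(a, w) \<in> A_seq r u \<alpha> a b J i"
    "((a, w), (c, v)) \<in> first_return T ({a} \<times> J \<union> {b} \<times> J)" by blast
  then have "(c, v) \<in> {a} \<times> J \<union> {b} \<times> J" unfolding first_return_def by simp
  with 1 have "v \<in> snd ` (first_return T ({a} \<times> J \<union> {b} \<times> J) `` A_seq r u \<alpha> a b J i
      \<inter> ({a} \<times> J \<union> {b} \<times> J))"
    by (intro rev_image_eqI[of "(c, v)"]) auto
  then show ?L unfolding A_seq.simps Let_def by simp
qed

text \<open>A first return runs along a dissipative orbit: the geodesic misses \<open>B\<close>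
  before its last step, and the last step ends on \<open>A\<close> after redirection. Each return
  takes at least one step, so \<open>i\<close> returns give a history of at least \<open>i\<close>
  steps.\<close>

lemma A_seq_in_image_fibre:
  assumes "generic \<alpha> D.\<tau> v" "(a, v) \<in> A_seq r u \<alpha> a b J i"
  shows "a \<in> D.image_fibre i v"
  using assms
proof (induction i arbitrary: v)
  case (Suc i)
  let ?E = "{a} \<times> J \<union> {b} \<times> J"
  obtain w c where w: "(a, w) \<in> A_seq r u \<alpha> a b J i" "((a, w), (c, v)) \<in> first_return T ?E"
    using Suc.prems(2) unfolding A_seq_Suc_iff by blast
  obtain n where n: "n \<ge> 1" "((a, w), (c, v)) \<in> T ^^ n" "c = a \<or> c = b" "v \<in> J" "w \<in> J"
    "\<And>m z. 1 \<le> m \<Longrightarrow> m < n \<Longrightarrow> ((a, w), z) \<in> T ^^ m \<Longrightarrow> z \<notin> ?E"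
    using w(2) unfolding first_return_def by auto
  have w_gen: "generic \<alpha> D.\<tau> w"
    using next_edge_pt_relpow_backward[OF D.periodic n(2) Suc.prems(1)] by simp
  have "0 \<le> w" "w < 1" using n J_subset by auto
  note rp = next_edge_pt_relpow_iff[OF nonsingular_generic[OF w_gen] this]
  obtain n' where n': "n = Suc n'" using n(1) by (cases n) auto
  have "D.iter n' w a = G.iter n' w a"
  proof (rule dissipative_iter_eq)
    fix m assume "1 \<le> m" "m \<le> n'"
    then show "\<not> (G.iter m w a = b \<and> frac (w + real m * \<alpha>) \<in> J)"
      using n(6)[of m "(G.iter m w a, frac (w + real m * \<alpha>))"] rp n' by auto
  qed
  moreover have v: "v = frac (w + real n * \<alpha>)" and c: "c = G.iter n w a" using n(2) rp by auto
  have fm: "w + real n' * \<alpha> + \<alpha> = w + real n * \<alpha>" by (simp add: n' algebra_simps)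
  have "frac (w + real n' * \<alpha> + \<alpha>) \<in> J" unfolding fm using n(4) v by simp
  from dissipative_step_iff[OF this, of "G.iter n' w a"] n(3) c
  have "D.\<tau> (w + real n' * \<alpha>) (G.iter n' w a) = a" by (simp add: n')
  ultimately have "D.iter n w a = a" by (simp add: n')
  moreover have "a \<in> D.image_fibre i w" using Suc.IH w_gen w(1) by blast
  ultimately have "a \<in> D.image_fibre (i + n) (w + real n * \<alpha>)"
    using D.iter_in_image_fibre_add[of a i w n] by simp
  then have "a \<in> D.image_fibre (i + n) v" by (simp add: v D.image_fibre_frac)
  \<comment> \<open>The return may take \<open>n > 1\<close> steps; nesting reduces the longer
    history to \<open>Suc i\<close> steps.\<close>
  then show ?case using D.image_fibre_antimono[of "Suc i" "i + n"] n(1) by auto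
qed simp

definition target :: "real \<Rightarrow> 's set" where
  "target v = (if frac v \<in> J then {a} \<inter> D.attractor v else {})"

lemma piecewise_const_target: "piecewise_const target"
  using piecewise_const_comp2[OF piecewise_J D.piecewise_const_attractor,
      of "\<lambda>t A. if t then {a} \<inter> A else {}"]
  by (simp add: target_def[abs_def])

lemma target_periodic: "target (v + 1) = target v"
  by (simp add: target_def frac_1_eq D.attractor_periodic)

lemma target_subset: "target v \<subseteq> D.attractor v"
  by (simp add: target_def)

text \<open>A point of \<open>A\<close> in the attractor is the first return of an earlier such point: take the last
  visit to \<open>A\<close> on the recurrent orbit.\<close>

lemma target_in_A_seq:
  assumes "generic \<alpha> (\<lambda>v. (D.\<tau> v, target v)) v" "v \<in> J" "a \<in> target v"
  shows "(a, v) \<in> A_seq r u \<alpha> a b J i"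
  using assms
proof (induction i arbitrary: v)
  case (Suc i)
  let ?E = "{a} \<times> J \<union> {b} \<times> J"
  define R where "R k \<longleftrightarrow> k \<ge> 1 \<and> a \<in> target (v - real k * \<alpha>) \<and> D.iter k (v - real k * \<alpha>) a = a" for k
  obtain k0 s' where "k0 \<ge> 1" "s' \<in> target (v - real k0 * \<alpha>)" "D.iter k0 (v - real k0 * \<alpha>) s' = a"
    using D.recurrence[OF piecewise_const_target target_periodic target_subset Suc.prems(1,3)] .
  then have "R k0" unfolding R_def by (auto simp: target_def split: if_splits)
  \<comment> \<open>The smallest return time going backwards in time picks the latest visit to the
    target before \<open>v\<close>.\<close>
  define k where "k = (LEAST k. R k)"
  have "R k" unfolding k_def using \<open>R k0\<close> by (rule LeastI)
  then have k: "k \<ge> 1" "a \<in> target (v - real k * \<alpha>)" "D.iter k (v - real k * \<alpha>) a = a"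
    unfolding R_def by auto
  define w0 where "w0 = v - real k * \<alpha>"
  define w where "w = frac w0"
  have w0_gen: "generic \<alpha> (\<lambda>v. (D.\<tau> v, target v)) w0"
    unfolding w0_def by (rule generic_shift(2)[OF Suc.prems(1)])
  then have w_gen: "generic \<alpha> (\<lambda>v. (D.\<tau> v, target v)) w"
    unfolding w_def by (subst generic_frac) (auto simp: D.periodic target_periodic)
  have w: "w \<in> J" "a \<in> target w" "a \<in> D.attractor w0"
    using k(2) by (auto simp: w_def w0_def target_def D.attractor_frac split: if_splits)
  have fr: "frac (w + real m * \<alpha>) = frac (w0 + real m * \<alpha>)" for m
    by (simp add: w_def frac_frac_add)
  have it: "D.iter m w = D.iter m w0" for m by (simp add: w_def D.iter_frac)
  \<comment> \<open>An intermediate visit to \<open>A\<close> lies in the attractor, hence in the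
    target, and would give the smaller return time \<open>k - m\<close>.\<close>
  have no_visit: "\<not> (D.iter m w a = a \<and> frac (w + real m * \<alpha>) \<in> J)" if m: "1 \<le> m" "m < k" for m
  proof
    assume *: "D.iter m w a = a \<and> frac (w + real m * \<alpha>) \<in> J"
    have eq: "v - real (k - m) * \<alpha> = w0 + real m * \<alpha>"
      using m by (simp add: w0_def of_nat_diff algebra_simps)
    have "D.iter m w0 a \<in> D.attractor (w0 + real m * \<alpha>)"
      using D.iter_in_attractor[OF _ w(3)] generic_comp[OF w0_gen, of fst] by simp
    then have "a \<in> target (w0 + real m * \<alpha>)" using * by (simp add: target_def it fr)
    moreover have "D.iter (k - m) (w0 + real m * \<alpha>) a = a"
      using D.iter_add[of "k - m" m w0] m * k(3) by (simp add: it w0_def)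
    ultimately have "R (k - m)" unfolding R_def eq using m by simp
    then have "k \<le> k - m" unfolding k_def by (rule Least_le)
    then show False using m by simp
  qed
  have eq: "G.iter m w a = D.iter m w a" if "m < k" for m
    by (rule geodesic_iter_eq) (use no_visit that in auto)
  have "nonsingular w" using nonsingular_generic[OF w_gen] .
  note rp = next_edge_pt_relpow_iff[OF this, unfolded w_def, OF frac_ge_0 frac_lt_1, folded w_def]
  have v: "frac (w + real k * \<alpha>) = v"
    using Suc.prems(2) J_subset fr[of k] by (auto simp: w0_def frac_eq)
  obtain k' where k': "k = Suc k'" using k(1) by (cases k) auto
  have fk: "w + real k' * \<alpha> + \<alpha> = w + real k * \<alpha>" by (simp add: k' algebra_simps)
  have "frac (w + real k' * \<alpha> + \<alpha>) \<in> J" unfolding fk using v Suc.prems(2) by simp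
  moreover have "D.iter k w a = a" using k(3) it[of k] by (simp add: w0_def)
  then have "D.\<tau> (w + real k' * \<alpha>) (D.iter k' w a) = a" unfolding k' by simp
  \<comment> \<open>The geodesic may end on \<open>A\<close> or on \<open>B\<close>;
    \<open>A_seq\<close> records only the height, so both are the required return.\<close>
  ultimately have "G.iter k w a = a \<or> G.iter k w a = b"
    using dissipative_step_iff[of "w + real k' * \<alpha>"] eq[of k'] k' by simp
  moreover have "((a, w), (G.iter k w a, v)) \<in> T ^^ k" using rp v by simp
  moreover have "z \<notin> ?E" if m: "1 \<le> m" "m < k" "((a, w), z) \<in> T ^^ m" for m z
  proof -
    obtain m' where m': "m = Suc m'" using m(1) by (cases m) auto
    have fm: "w + real m' * \<alpha> + \<alpha> = w + real m * \<alpha>" by (simp add: m' algebra_simps)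
    have "z = (D.iter m w a, frac (w + real m * \<alpha>))" using rp m eq by simp
    moreover have "D.iter m w a \<noteq> b" if "frac (w + real m * \<alpha>) \<in> J"
      using dissipative_step_not_b[of "w + real m' * \<alpha>" "D.iter m' w a"] that fm m' by simp
    ultimately show ?thesis using no_visit[OF m(1,2)] by auto
  qed
  ultimately have "((a, w), (G.iter k w a, v)) \<in> first_return T ?E"
    unfolding first_return_def using k(1) w(1) Suc.prems(2) by blast
  moreover have "(a, w) \<in> A_seq r u \<alpha> a b J i" using Suc.IH[OF w_gen w(1,2)] .
  ultimately show ?case unfolding A_seq_Suc_iff by blast
qed simp

text \<open>At generic heights \<open>A_seq\<close> at \<open>N\<close> is contained in the target
  by stabilization of the images, and the target is contained in every later set by recurrence. So
  the difference of two consecutive sets is countable.\<close>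

lemma terminates: "extension_process_terminates r u \<alpha> a b J"
proof -
  define N where "N = D.stable_time"
  let ?D = "snd ` (A_seq r u \<alpha> a b J N - A_seq r u \<alpha> a b J (Suc N))"
  let ?g = "\<lambda>v. (D.\<tau> v, target v)"
  have "?D \<subseteq> {v. \<not> generic \<alpha> ?g v}"
  proof (rule subsetI, rule ccontr)
    fix v assume "v \<in> ?D" and "v \<notin> {v. \<not> generic \<alpha> ?g v}"
    then have v: "(a, v) \<in> A_seq r u \<alpha> a b J N" "(a, v) \<notin> A_seq r u \<alpha> a b J (Suc N)"
      "v \<in> J" "generic \<alpha> ?g v"
      using A_seq_subset[of N] by auto
    have "generic \<alpha> D.\<tau> v" using generic_comp[OF v(4), of fst] by simp
    from A_seq_in_image_fibre[OF this v(1)] D.attractor_eq[OF this, of N]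
    have "a \<in> D.attractor v" by (simp add: N_def)
    moreover have "frac v = v" using v(3) J_subset by (auto simp: frac_eq)
    ultimately have "a \<in> target v" using v(3) by (simp add: target_def)
    then show False using target_in_A_seq[OF v(4,3)] v(2) by blast
  qed
  moreover have "countable {v. \<not> generic \<alpha> ?g v}"
    by (rule countable_not_generic) (rule piecewise_const_comp2[OF D.piecewise piecewise_const_target])
  ultimately have "countable ?D" by (rule countable_subset)
  then have "?D \<in> null_sets lebesgue"
    by (intro null_sets_completionI countable_imp_null_set_lborel)
  then show ?thesis unfolding extension_process_terminates_def
    by (intro exI[of _ "Suc N"]) simp
qed

end

section \<open>Strips as polygons on the surface\<close>

lemma surface_pt_eqD: "surface_pt r u p = surface_pt r u q \<Longrightarrow> (p, q) \<in> (glue r u \<union> (glue r u)\<inverse>)\<^sup>*"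
  unfolding surface_pt_def by blast

lemma surface_pt_glue:
  assumes "(p, q) \<in> glue r u"
  shows "surface_pt r u p = surface_pt r u q"
proof -
  have "sym ((glue r u \<union> (glue r u)\<inverse>)\<^sup>*)" by (rule sym_rtrancl) (auto simp: sym_def)
  moreover have "(p, q) \<in> (glue r u \<union> (glue r u)\<inverse>)\<^sup>*" using assms by blast
  ultimately show ?thesis unfolding surface_pt_def
    by (auto dest: symD intro: rtrancl_trans)
qed

text \<open>Off the vertical edges only top and bottom edges are glued. A chain of gluings can then
  only go back and forth across one edge, and injectivity of \<open>u\<close> makes it return to the
  same square.\<close>

lemma surface_pt_off_vertical_edges:
  assumes "inj u" "0 < x" "x < 1" "surface_pt r u (s, x, y) = surface_pt r u (s', x', y')"
  shows "x' = x \<and> (s' = s \<and> y' = y \<or> y = 1 \<and> y' = 0 \<and> s' = u s \<or> y = 0 \<and> y' = 1 \<and> s = u s')"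
proof -
  have "x' = x \<and> (s' = s \<and> y' = y \<or> y = 1 \<and> y' = 0 \<and> s' = u s \<or> y = 0 \<and> y' = 1 \<and> s = u s')"
    if "((s, x, y), q) \<in> (glue r u \<union> (glue r u)\<inverse>)\<^sup>*" "q = (s', x', y')" for q s' x' y'
    using that
  proof (induction arbitrary: s' x' y' rule: rtrancl_induct)
    case (step q q')
    obtain s1 x1 y1 where q: "q = (s1, x1, y1)" by (cases q)
    note IH = step.IH[OF q]
    have "x1 = x" using IH by blast
    then have "x' = x \<and> (y1 = 1 \<and> y' = 0 \<and> s' = u s1 \<or> y1 = 0 \<and> y' = 1 \<and> s1 = u s')"
      using step.hyps(2) assms(2,3) unfolding q step.prems glue_def by auto
    then show ?case using IH injD[OF assms(1)] by auto
  qed auto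
  from this[OF surface_pt_eqD[OF assms(4)] refl] show ?thesis .
qed

lemma surface_pt_interior:
  assumes "inj u" "0 < x" "x < 1" "0 < y" "y < 1"
    and "surface_pt r u (s, x, y) = surface_pt r u (s', x', y')"
  shows "s' = s \<and> x' = x \<and> y' = y"
  using surface_pt_off_vertical_edges[OF assms(1-3,6)] assms(4,5) by auto

definition strip :: "real \<Rightarrow> real \<Rightarrow> real \<Rightarrow> (real \<times> real) set" where
  "strip \<alpha> p q = {(x, w). 0 < x \<and> x < 1 \<and> p + \<alpha> * x < w \<and> w < q + \<alpha> * x}"

text \<open>The parallelogram is the image of a rectangle under the linear shear \<open>L\<close>.
  Simplicity of the boundary is inherited from \<open>rectpath\<close>, and the inside is the
  interior of a compact convex set.\<close>

lemma strip_polygon: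
  assumes "p < q"
  obtains vs where "closed_polygon vs" "edges_vertical_or_slope \<alpha> vs"
    "inside (path_image (polygonal_path vs)) = strip \<alpha> p q"
proof -
  define vs :: "(real \<times> real) list" where "vs = [(0, p), (1, p + \<alpha>), (1, q + \<alpha>), (0, q), (0, p)]"
  define L :: "complex \<Rightarrow> real \<times> real" where "L z = (Re z, Im z + \<alpha> * Re z)" for z
  define R where "R = rectpath (Complex 0 p) (Complex 1 q)"
  have lin: "linear L" by (rule linearI) (simp_all add: L_def algebra_simps)
  have L_inv: "L (Complex x (w - \<alpha> * x)) = (x, w)" for x w by (simp add: L_def)
  have inj: "inj L" by (rule injI) (auto simp: L_def complex_eq_iff)
  moreover have "surj L"
    by (rule surjI[of _ "\<lambda>z. Complex (fst z) (snd z - \<alpha> * fst z)"]) (simp add: L_def)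
  ultimately have bij: "bij L" by (rule bijI)
  have path: "polygonal_path vs = L \<circ> R"
  proof -
    have lp: "L \<circ> linepath z w = linepath (L z) (L w)" for z w
      by (auto simp: fun_eq_iff linepath_def linear_add[OF lin] linear_cmul[OF lin])
    show ?thesis
      unfolding R_def rectpath_def Let_def joinpaths_linear_image[OF lin, symmetric] lp
      by (simp add: vs_def L_def)
  qed
  have "simple_path (polygonal_path vs)"
    unfolding path simple_path_linear_image_eq[OF lin inj] R_def
    by (rule simple_path_rectpath) (use assms in auto)
  then have closed: "closed_polygon vs" by (simp add: closed_polygon_def vs_def)
  have edges: "edges_vertical_or_slope \<alpha> vs"
    unfolding edges_vertical_or_slope_def vs_def by (auto simp: less_Suc_eq nth_Cons')
  let ?C = "cbox (Complex 0 p) (Complex 1 q)" and ?B = "box (Complex 0 p) (Complex 1 q)"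
  have "compact (L ` ?C)"
    by (intro compact_continuous_image linear_continuous_on compact_cbox)
      (simp add: lin linear_conv_bounded_linear[symmetric])
  then have "closure (L ` ?C) = L ` ?C" by (simp add: compact_imp_closed)
  moreover have int: "interior (L ` ?C) = L ` ?B"
    by (simp add: interior_bijective_linear_image[OF lin bij] interior_cbox)
  ultimately have "frontier (L ` ?C) = L ` (?C - ?B)"
    by (simp add: frontier_def image_set_diff[OF inj])
  moreover have "path_image (polygonal_path vs) = L ` (?C - ?B)"
    unfolding path path_image_compose R_def
    by (subst path_image_rectpath_cbox_minus_box) (use assms in auto)
  ultimately have "inside (path_image (polygonal_path vs)) = inside (frontier (L ` ?C))" by simp
  also have "\<dots> = interior (L ` ?C)"
    using \<open>compact (L ` ?C)\<close> convex_linear_image[OF lin convex_box(1)]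
    by (intro inside_frontier_eq_interior) (auto intro: compact_imp_bounded)
  also have "\<dots> = strip \<alpha> p q"
    unfolding int
  proof (intro set_eqI iffI)
    fix z assume "z \<in> L ` ?B"
    then show "z \<in> strip \<alpha> p q" by (auto simp: L_def strip_def in_box_complex_iff)
  next
    fix z assume z: "z \<in> strip \<alpha> p q"
    obtain x w where "z = (x, w)" by (cases z)
    with z show "z \<in> L ` ?B"
      by (intro image_eqI[of _ _ "Complex x (w - \<alpha> * x)"])
        (auto simp: L_inv strip_def in_box_complex_iff)
  qed
  finally show ?thesis using that closed edges by blast
qed

lemma negligible_vertical_line: "negligible {z :: real \<times> real. fst z = t}"
  using negligible_hyperplane[of "(1, 0) :: real \<times> real" t] by (simp add: inner_prod_def zero_prod_def)

lemma negligible_line: "negligible {z :: real \<times> real. snd z - m * fst z = t}"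
  using negligible_hyperplane[of "(- m, 1) :: real \<times> real" t] by (simp add: inner_prod_def zero_prod_def)

lemma finite_gap_around:
  fixes K :: "real set"
  assumes "finite K" "l \<in> K" "h \<in> K" "l < v" "v < h" "v \<notin> K"
  obtains p q where "p \<in> K" "q \<in> K" "p < v" "v < q" "\<forall>k\<in>K. k \<le> p \<or> q \<le> k"
proof -
  have 1: "finite {k \<in> K. k < v}" "{k \<in> K. k < v} \<noteq> {}" "finite {k \<in> K. v < k}" "{k \<in> K. v < k} \<noteq> {}"
    using assms by auto
  show ?thesis
  proof (rule that)
    show "Max {k \<in> K. k < v} \<in> K" "Max {k \<in> K. k < v} < v" using Max_in[OF 1(1,2)] by auto
    show "Min {k \<in> K. v < k} \<in> K" "v < Min {k \<in> K. v < k}" using Min_in[OF 1(3,4)] by auto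
    show "\<forall>k\<in>K. k \<le> Max {k \<in> K. k < v} \<or> Min {k \<in> K. v < k} \<le> k"
    proof
      fix k assume k: "k \<in> K"
      have "k \<noteq> v" using assms(6) k by blast
      then consider "k < v" | "v < k" by linarith
      then show "k \<le> Max {k \<in> K. k < v} \<or> Min {k \<in> K. v < k} \<le> k"
        using Max_ge[OF 1(1), of k] Min_le[OF 1(3), of k] k by cases auto
    qed
  qed
qed

section \<open>Strips unrolled along a column of squares\<close>

context edge_flow
begin

text \<open>The squares \<open>c\<close>, \<open>u c\<close>, \<open>u (u c)\<close> and so on are
  stacked, and \<open>snd z\<close> is the height above the bottom of \<open>c\<close>. Negative
  heights are cut off by \<open>nat\<close>; strips with \<open>0 \<le> p\<close> do not reach
  them.\<close>

definition strip_map :: "'s \<Rightarrow> real \<times> real \<Rightarrow> 's pt set" where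
  "strip_map c z = surface_pt r u ((u ^^ nat \<lfloor>snd z\<rfloor>) c, fst z, frac (snd z))"

lemma inj_u: "inj u"
  using bij_u by (rule bij_is_inj)

text \<open>Both ends of the height range are allowed, so a point of a horizontal edge may be read
  in either adjacent square, as \<open>local_translation\<close> demands.\<close>

lemma strip_map_eq:
  assumes "0 \<le> x" "x \<le> 1" "0 \<le> w - real k" "w - real k \<le> 1"
  shows "strip_map c (x, w) = surface_pt r u ((u ^^ k) c, x, w - real k)"
proof (cases "w - real k < 1")
  case True
  then have "\<lfloor>w\<rfloor> = int k" using assms by (intro floor_unique) simp_all
  then show ?thesis by (simp add: strip_map_def frac_def)
next
  case False
  then have w: "w = real (Suc k)" using assms by simp
  then have "\<lfloor>w\<rfloor> = int (Suc k)" by (simp only: floor_of_nat)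
  then have "strip_map c (x, w) = surface_pt r u (u ((u ^^ k) c), x, 0)"
    by (simp only: strip_map_def frac_def fst_conv snd_conv nat_int) (simp add: w)
  moreover have "(((u ^^ k) c, x, 1), (u ((u ^^ k) c), x, 0)) \<in> glue r u"
    using assms by (auto simp: glue_def)
  ultimately show ?thesis using surface_pt_glue w by fastforce
qed

lemma stripE:
  assumes "z \<in> strip \<alpha> p q" "0 \<le> p"
  obtains x w k where "z = (x, w)" "0 < x" "x < 1" "p + \<alpha> * x < w" "w < q + \<alpha> * x" "0 < w"
    "\<lfloor>w\<rfloor> = int k" "0 \<le> w - real k" "w - real k < 1"
    "\<And>c. strip_map c z = surface_pt r u ((u ^^ k) c, x, w - real k)"
proof -
  obtain x w where z: "z = (x, w)" by (cases z)
  then have *: "0 < x" "x < 1" "p + \<alpha> * x < w" "w < q + \<alpha> * x" using assms(1) by (auto simp: strip_def)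
  moreover have "0 < \<alpha> * x" using * slope_pos by simp
  ultimately have "0 < w" using assms(2) by linarith
  define k where "k = nat \<lfloor>w\<rfloor>"
  have k: "\<lfloor>w\<rfloor> = int k" using \<open>0 < w\<close> by (simp add: k_def)
  have "0 \<le> w - real k" "w - real k < 1" using floor_correct[of w] k by simp_all
  then show ?thesis using that[OF z * \<open>0 < w\<close> k] strip_map_eq[of x w k] * z by simp
qed

lemma strip_surface_polygon:
  assumes "0 \<le> p" "p < q" "q \<le> 1"
  shows "surface_polygon r u \<alpha> (strip_map c ` strip \<alpha> p q)"
proof -
  obtain vs where vs: "closed_polygon vs" "edges_vertical_or_slope \<alpha> vs"
    "inside (path_image (polygonal_path vs)) = strip \<alpha> p q"
    using strip_polygon[OF assms(2)] .
  have "local_translation r u (strip \<alpha> p q) (strip_map c)"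
    unfolding local_translation_def
  proof (intro conjI ballI allI impI)
    show "strip_map c ` strip \<alpha> p q \<subseteq> surface r u"
    proof
      fix P assume "P \<in> strip_map c ` strip \<alpha> p q"
      then obtain z where "z \<in> strip \<alpha> p q" "P = strip_map c z" by blast
      with assms(1) show "P \<in> surface r u"
        by (auto elim!: stripE simp: surface_def closed_square_def)
    qed
    fix z s w'
    assume z: "z \<in> strip \<alpha> p q" and w': "w' \<in> closed_square" "strip_map c z = surface_pt r u (s, w')"
    obtain x w k where xw: "z = (x, w)" "0 < x" "x < 1" "0 < w" "0 \<le> w - real k" "w - real k < 1"
      "strip_map c z = surface_pt r u ((u ^^ k) c, x, w - real k)"
      using stripE[OF z assms(1)] by metis
    obtain x' y' where xy': "w' = (x', y')" by (cases w')
    from surface_pt_off_vertical_edges[OF inj_u xw(2,3)] xw(7) w'(2) xy'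
    have *: "x' = x \<and> (s = (u ^^ k) c \<and> y' = w - real k \<or> w - real k = 1 \<and> y' = 0 \<and> s = u ((u ^^ k) c) \<or>
        w - real k = 0 \<and> y' = 1 \<and> (u ^^ k) c = u s)" by metis
    \<comment> \<open>A point with \<open>w = real k\<close> is also on the top edge of the square
      one level lower; that level exists because \<open>w > 0\<close>.\<close>
    obtain k' where k': "s = (u ^^ k') c" "y' = w - real k'"
    proof (cases "s = (u ^^ k) c \<and> y' = w - real k")
      case True
      then show ?thesis using that by blast
    next
      case False
      then have 1: "w = real k" "y' = 1" "(u ^^ k) c = u s" using * xw(6) by linarith+
      then obtain j where j: "k = Suc j" using xw(4) by (cases k) auto
      then have "s = (u ^^ j) c" using 1(3) inj_u by (simp add: inj_eq)
      then show ?thesis using that[of j] 1 j by simp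
    qed
    show "\<exists>\<epsilon>>0. \<forall>h. norm h < \<epsilon> \<and> w' + h \<in> closed_square \<longrightarrow>
        strip_map c (z + h) = surface_pt r u (s, w' + h)"
    \<comment> \<open>Any radius would serve, since \<open>strip_map_eq\<close> covers the whole
      closed square at level \<open>k'\<close>.\<close>
    proof (intro exI[of _ 1] conjI allI impI)
      fix h assume "norm h < 1 \<and> w' + h \<in> closed_square"
      moreover obtain h1 h2 where h: "h = (h1, h2)" by (cases h)
      moreover have e: "w + h2 - real k' = y' + h2" using k'(2) by simp
      ultimately show "strip_map c (z + h) = surface_pt r u (s, w' + h)"
        using strip_map_eq[of "x + h1" "w + h2" k' c, unfolded e] k'(1) * xw(1) xy'
        by (simp add: closed_square_def)
    qed simp
  qed
  moreover have "inj_on (strip_map c) (strip \<alpha> p q)"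
  proof (rule inj_onI)
    fix z z' assume z: "z \<in> strip \<alpha> p q" "z' \<in> strip \<alpha> p q" "strip_map c z = strip_map c z'"
    obtain x w k where 1: "z = (x, w)" "0 < x" "x < 1" "p + \<alpha> * x < w" "w < q + \<alpha> * x"
      "strip_map c z = surface_pt r u ((u ^^ k) c, x, w - real k)"
      using stripE[OF z(1) assms(1)] by metis
    obtain x' w' k' where 2: "z' = (x', w')" "p + \<alpha> * x' < w'" "w' < q + \<alpha> * x'"
      "strip_map c z' = surface_pt r u ((u ^^ k') c, x', w' - real k')"
      using stripE[OF z(2) assms(1)] by metis
    have *: "x' = x \<and> (w' - real k' = w - real k \<or> w - real k = 1 \<and> w' - real k' = 0 \<or>
        w - real k = 0 \<and> w' - real k' = 1)"
      using surface_pt_off_vertical_edges[OF inj_u 1(2,3)] 1(6) 2(4) z(3) by metis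
    \<comment> \<open>A vertical section of the strip is an open interval of length at most 1, so
      two heights in it that differ by an integer are equal.\<close>
    have "\<bar>w' - w\<bar> < 1" using 1(4,5) 2(2,3) * assms by auto
    have "\<exists>j::int. w' - w = of_int j"
      using * by (elim conjE disjE; intro exI[of _ "int k' - int k"] exI[of _ "int k' - int k - 1"]
          exI[of _ "int k' - int k + 1"]) auto
    then obtain j :: int where "w' - w = of_int j" by blast
    moreover from this have "j = 0" using \<open>\<bar>w' - w\<bar> < 1\<close> by linarith
    ultimately have "w' = w" by simp
    then show "z = z'" using * 1 2 by simp
  qed
  ultimately show ?thesis unfolding surface_polygon_def Let_def
    using vs by (intro exI[of _ vs] exI[of _ "strip_map c"]) simp
qed

lemma strip_map_in_image:
  assumes "0 < x" "0 \<le> p" "q \<le> 1" "0 < y" "y < 1" "x < 1"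
    and "surface_pt r u (s, x, y) \<in> strip_map c ` strip \<alpha> p q"
  obtains v where "p < v" "v < q" "on_line c v x (s, x, y)"
proof -
  obtain z where z: "z \<in> strip \<alpha> p q" "surface_pt r u (s, x, y) = strip_map c z"
    using assms(7) by blast
  obtain x' w k where xw: "z = (x', w)" "0 < x'" "x' < 1" "p + \<alpha> * x' < w" "w < q + \<alpha> * x'"
    "0 \<le> w - real k" "w - real k < 1"
    "strip_map c z = surface_pt r u ((u ^^ k) c, x', w - real k)"
    using stripE[OF z(1) assms(2)] by metis
  from surface_pt_interior[OF inj_u assms(1,6,4,5)] z(2) xw(8)
  have eq: "(u ^^ k) c = s" "x' = x" "w - real k = y" by metis+
  have v: "p < w - \<alpha> * x" "w - \<alpha> * x < q" using xw(4,5) eq(2) by simp_all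
  then have "frac (w - \<alpha> * x) = w - \<alpha> * x" using assms(2,3) by (simp add: frac_eq)
  then have "on_line c (w - \<alpha> * x) x (s, x, y)"
    by (intro on_lineI[of _ _ k]) (use assms eq in auto)
  then show ?thesis using that v by blast
qed

lemma strip_map_in_imageI:
  assumes "0 < x" "p < v" "v < q" "0 \<le> p" "q \<le> 1" "on_line c v x (s, x, y)"
  shows "surface_pt r u (s, x, y) \<in> strip_map c ` strip \<alpha> p q"
proof -
  obtain k where k: "x < 1" "s = (u ^^ k) c" "y = frac v + \<alpha> * x - real k" "0 \<le> y" "y < 1"
    using assms(6) by (auto elim: on_lineE)
  have v: "frac v = v" using assms by (simp add: frac_eq)
  have "strip_map c (x, v + \<alpha> * x) = surface_pt r u (s, x, y)"
    using strip_map_eq[of x "v + \<alpha> * x" k c] k assms(1) v by simp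
  moreover have "(x, v + \<alpha> * x) \<in> strip \<alpha> p q" using assms k by (simp add: strip_def)
  ultimately show ?thesis by (metis imageI)
qed

text \<open>The discontinuities of \<open>g\<close> cut [0, 1] into finitely many intervals on which
  \<open>g\<close> is constant, and each square \<open>c\<close> in that value contributes one
  strip. Only generic lines through the interiors of the squares have to be examined.\<close>

lemma finite_union_of_polygons_sections:
  assumes f: "piecewise_const f" "\<And>v. f (v + 1) = f v"
    and g: "piecewise_const g" "\<And>v. generic \<alpha> f v \<Longrightarrow> locally_const g v"
    and M: "\<And>c v s x y. \<lbrakk>generic \<alpha> f v; 0 < v; v < 1; 0 < x; x < 1; 0 < y; y < 1;
      on_line c v x (s, x, y)\<rbrakk> \<Longrightarrow> surface_pt r u (s, x, y) \<in> M \<longleftrightarrow> c \<in> g v"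
  shows "finite_union_of_polygons r u \<alpha> M"
proof -
  define K where "K = {v \<in> {0..1}. \<not> locally_const g v} \<union> {0, 1}"
  have K: "finite K" "0 \<in> K" "1 \<in> K" "K \<subseteq> {0..1}"
    using piecewise_const_finite[OF g(1)] by (auto simp: K_def)
  define F where "F = (\<lambda>(c, p, q). strip_map c ` strip \<alpha> p q) `
    {(c, p, q). p \<in> K \<and> q \<in> K \<and> p < q \<and> (\<forall>v. p < v \<and> v < q \<longrightarrow> c \<in> g v)}"
  have "{(c, p, q). p \<in> K \<and> q \<in> K \<and> p < q \<and> (\<forall>v. p < v \<and> v < q \<longrightarrow> c \<in> g v)}
      \<subseteq> UNIV \<times> K \<times> K" by auto
  then have "finite F" unfolding F_def
    using K(1) by (intro finite_imageI) (auto intro: finite_subset)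
  have polygons: "surface_polygon r u \<alpha> Q" if "Q \<in> F" for Q
    using that K(4) unfolding F_def by (auto intro!: strip_surface_polygon)
  have key: "surface_pt r u (s, x, y) \<in> M \<longleftrightarrow> surface_pt r u (s, x, y) \<in> \<Union>F"
    if xy: "0 < x" "x < 1" "0 < y" "y < 1" and gen: "generic \<alpha> f (y - \<alpha> * x)" for s x y
  proof -
    obtain c v where cv: "0 \<le> v" "v < 1" "on_line c v x (s, x, y)" "frac v = frac (y - \<alpha> * x)"
      using on_line_exists[OF less_imp_le[OF xy(1)] xy(2) less_imp_le[OF xy(3)] xy(4)] .
    have v: "generic \<alpha> f v" using gen cv generic_frac[of f, OF f(2)] by (metis frac_eq)
    then have "v \<notin> \<int>" using generic_notin_Ints[OF v, of 0] by simp
    then have "0 < v" using cv(1) by (cases "v = 0") auto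
    have "v \<notin> K" using g(2)[OF v] cv(2) \<open>0 < v\<close> by (auto simp: K_def)
    obtain p q where pq: "p \<in> K" "q \<in> K" "p < v" "v < q" "\<forall>k\<in>K. k \<le> p \<or> q \<le> k"
      using finite_gap_around[OF K(1,2,3) \<open>0 < v\<close> cv(2) \<open>v \<notin> K\<close>] .
    have pq01: "0 \<le> p" "q \<le> 1" using pq K by auto
    have "locally_const g w" if "p < w" "w < q" for w
      using bspec[OF pq(5), of w] that pq01 by (auto simp: K_def)
    then obtain A where A: "\<And>w. p < w \<Longrightarrow> w < q \<Longrightarrow> g w = A"
      using piecewise_const_interval[of p q g] pq by (metis less_trans)
    have "c \<in> g v \<longleftrightarrow> surface_pt r u (s, x, y) \<in> \<Union>F"
    proof
      assume "c \<in> g v"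
      then have "strip_map c ` strip \<alpha> p q \<in> F"
        unfolding F_def using pq A by (intro image_eqI[of _ _ "(c, p, q)"]) auto
      moreover have "surface_pt r u (s, x, y) \<in> strip_map c ` strip \<alpha> p q"
        by (rule strip_map_in_imageI[OF xy(1) pq(3,4) pq01 cv(3)])
      ultimately show "surface_pt r u (s, x, y) \<in> \<Union>F" by blast
    next
      assume "surface_pt r u (s, x, y) \<in> \<Union>F"
      then obtain c' p' q' where *: "p' \<in> K" "q' \<in> K" "\<forall>v. p' < v \<and> v < q' \<longrightarrow> c' \<in> g v"
        "surface_pt r u (s, x, y) \<in> strip_map c' ` strip \<alpha> p' q'"
        unfolding F_def by auto
      then have pq'01: "0 \<le> p'" "q' \<le> 1" using K by auto
      obtain v' where v': "p' < v'" "v' < q'" "on_line c' v' x (s, x, y)"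
        using strip_map_in_image[OF xy(1) pq'01 xy(3,4,2) *(4)] .
      have "c' = c" "frac v' = frac v" using on_line_unique[OF cv(3) v'(3)] by auto
      moreover have "frac v' = v'" "frac v = v" using v' pq'01 cv by (simp_all add: frac_eq)
      ultimately show "c \<in> g v" using * v' by auto
    qed
    then show ?thesis using M[OF v \<open>0 < v\<close> cv(2) xy cv(3)] by blast
  qed
  \<comment> \<open>The ignored points: the edges of the square and countably many lines of slope
    \<alpha>. Horizontal edges are written with slope 0 to fit
    \<open>negligible_line\<close>.\<close>
  define Ex :: "(real \<times> real) set" where
    "Ex = {z. fst z = 0} \<union> {z. fst z = 1} \<union> {z. snd z - 0 * fst z = 0} \<union> {z. snd z - 0 * fst z = 1}
      \<union> \<Union>((\<lambda>t. {z. snd z - \<alpha> * fst z = t}) ` {t. \<not> generic \<alpha> f t})"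
  have "negligible Ex"
    unfolding Ex_def using countable_not_generic[OF f(1)]
    by (intro negligible_Un negligible_vertical_line negligible_line negligible_countable_Union)
      (auto intro: negligible_line)
  have null: "surface_null r u X" if "\<And>s x y. 0 < x \<Longrightarrow> x < 1 \<Longrightarrow> 0 < y \<Longrightarrow> y < 1 \<Longrightarrow>
      generic \<alpha> f (y - \<alpha> * x) \<Longrightarrow> surface_pt r u (s, x, y) \<notin> X" for X
    unfolding surface_null_def
  proof
    fix s
    have "part_in_square r u X s \<subseteq> Ex"
    proof
      fix z assume z: "z \<in> part_in_square r u X s"
      obtain x y where xy: "z = (x, y)" by (cases z)
      show "z \<in> Ex"
      proof (rule ccontr)
        assume "z \<notin> Ex"
        then have "x \<noteq> 0" "x \<noteq> 1" "y \<noteq> 0" "y \<noteq> 1" "generic \<alpha> f (y - \<alpha> * x)"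
          by (auto simp: Ex_def xy)
        then show False using that[of x y s] z xy by (auto simp: part_in_square_def closed_square_def)
      qed
    qed
    then show "part_in_square r u X s \<in> null_sets lebesgue"
      using \<open>negligible Ex\<close> negligible_subset negligible_iff_null_sets by blast
  qed
  show ?thesis unfolding finite_union_of_polygons_def
    using \<open>finite F\<close> polygons by (intro exI[of _ F] conjI ballI null) (auto simp: key)
qed

end

section \<open>Wandering points\<close>

lemma surface_open_in_square:
  assumes "inj u" "open O'" "O' \<subseteq> {0<..<1} \<times> {0<..<1}"
  shows "surface_open r u ((\<lambda>z. surface_pt r u (s, z)) ` O')"
  unfolding surface_open_def
proof (intro conjI allI)
  show "(\<lambda>z. surface_pt r u (s, z)) ` O' \<subseteq> surface r u"
    using assms(3) unfolding surface_def closed_square_def by fastforce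
  fix t
  have "part_in_square r u ((\<lambda>z. surface_pt r u (s, z)) ` O') t = (if t = s then O' else {})"
    (is "?P = _")
  proof (intro set_eqI iffI)
    fix z assume "z \<in> ?P"
    then obtain z' where z': "z' \<in> O'" "surface_pt r u (s, z') = surface_pt r u (t, z)"
      unfolding part_in_square_def by auto
    obtain x y where xy: "z' = (x, y)" by (cases z')
    then have "0 < x" "x < 1" "0 < y" "y < 1" using z' assms(3) by auto
    from surface_pt_interior[OF assms(1) this, of r s t "fst z" "snd z"] z'
    show "z \<in> (if t = s then O' else {})" by (auto simp: xy)
  next
    fix z assume "z \<in> (if t = s then O' else {})"
    then have "t = s" "z \<in> O'" by (auto split: if_splits)
    then show "z \<in> ?P" using assms(3) unfolding part_in_square_def closed_square_def by fastforce
  qed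
  moreover have "O' \<subseteq> closed_square" using assms(3) unfolding closed_square_def by fastforce
  ultimately show "openin (top_of_set closed_square) ?P"
    using assms(2) by (simp add: open_subset)
qed

context barrier
begin

text \<open>The number \<open>k\<close> of crossed horizontal edges is unchanged, because the
  shifted starting height stays between 0 and 1.\<close>

lemma on_line_move:
  assumes "D.on_line c v x (s, x, y)" "0 < v" "v < 1" "0 < v + d" "v + d < 1"
    and "0 \<le> x'" "x' < 1" "0 \<le> y'" "y' < 1" "y' - \<alpha> * x' = y - \<alpha> * x + d"
  shows "D.on_line c (v + d) x' (s, x', y')"
proof -
  obtain k where k: "s = (u ^^ k) c" "y = frac v + \<alpha> * x - real k"
    using assms(1) by (auto elim: D.on_lineE)
  have "frac v = v" "frac (v + d) = v + d" using assms by (simp_all add: frac_eq)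
  then show ?thesis by (intro D.on_lineI[of _ _ k]) (use assms k in auto)
qed

text \<open>The neighbourhood is a band of lines that all start from \<open>c\<close> at heights
  where \<open>c\<close> is outside the attractor. A late return would exhibit \<open>c\<close> as
  the end of a long orbit over such a height, hence inside the attractor.\<close>

lemma wandering_off_attractor:
  assumes v: "generic \<alpha> D.\<tau> v" "0 < v" "v < 1" and c: "c \<notin> D.attractor v"
    and p: "D.on_line c v x (s, x, y)" "0 < x" "x < 1" "0 < y" "y < 1"
  shows "wandering r u \<alpha> a b J (surface_pt r u (s, x, y))"
proof -
  obtain \<epsilon>1 where e1: "\<epsilon>1 > 0" "\<And>w. \<bar>w - v\<bar> < \<epsilon>1 \<Longrightarrow> D.attractor w = D.attractor v"
    using locally_constE[OF D.locally_const_attractor[OF v(1)]] by blast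
  define \<epsilon> where "\<epsilon> = min \<epsilon>1 (min v (1 - v))"
  have e: "\<epsilon> > 0" using e1 v by (simp add: \<epsilon>_def)
  have near: "0 < v + d \<and> v + d < 1 \<and> c \<notin> D.attractor (v + d)" if "\<bar>d\<bar> < \<epsilon>" for d
  proof -
    have "\<bar>d\<bar> < \<epsilon>1" "\<bar>d\<bar> < v" "\<bar>d\<bar> < 1 - v" using that by (simp_all add: \<epsilon>_def)
    moreover from this have "D.attractor (v + d) = D.attractor v" by (intro e1(2)) simp
    ultimately show ?thesis using c by (simp add: abs_less_iff)
  qed
  define O' :: "(real \<times> real) set" where "O' = {z. 0 < fst z \<and> fst z < 1 \<and> 0 < snd z \<and> snd z < 1 \<and>
    \<bar>snd z - \<alpha> * fst z - (y - \<alpha> * x)\<bar> < \<epsilon>}"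
  have "open O'" unfolding O'_def
    by (intro open_Collect_conj open_Collect_less continuous_intros)
  define D' where "D' = (\<lambda>z. surface_pt r u (s, z)) ` O'"
  have "surface_open r u D'" unfolding D'_def
    by (rule surface_open_in_square[OF D.inj_u \<open>open O'\<close>]) (auto simp: O'_def)
  moreover have "surface_pt r u (s, x, y) \<in> D'" unfolding D'_def
    using p e by (intro imageI) (simp add: O'_def)
  moreover have "D' \<inter> dissipative_image r u \<alpha> a b J t D' = {}"
    \<comment> \<open>The offsets \<open>x1\<close> and \<open>x3\<close> change
      \<open>t / D.\<kappa>\<close> by less than 1, so this bound leaves at least
      \<open>D.stable_time\<close> steps.\<close>
    if t: "t > real (D.stable_time + 2) * D.\<kappa>" for t
  proof (rule ccontr)
    assume "D' \<inter> dissipative_image r u \<alpha> a b J t D' \<noteq> {}"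
    then obtain p' q' where pq: "surface_pt r u p' \<in> D'" "surface_pt r u q' \<in> D'"
      "dissipative_flow r u \<alpha> a b J t p' q'"
      unfolding dissipative_image_def by blast
    have line: "\<exists>d x'. 0 \<le> x' \<and> x' < 1 \<and> \<bar>d\<bar> < \<epsilon> \<and> D.on_line c (v + d) x' q"
      if in_D: "surface_pt r u q \<in> D'" for q
    proof -
      obtain z where z: "z \<in> O'" "surface_pt r u (s, z) = surface_pt r u q"
        using in_D unfolding D'_def by auto
      obtain x' y' where xy: "z = (x', y')" by (cases z)
      obtain s2 x2 y2 where q: "q = (s2, x2, y2)" by (cases q)
      have z': "0 < x'" "x' < 1" "0 < y'" "y' < 1" "\<bar>y' - \<alpha> * x' - (y - \<alpha> * x)\<bar> < \<epsilon>"
        using z(1) by (simp_all add: O'_def xy)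
      have "q = (s, x', y')"
        using surface_pt_interior[OF D.inj_u z'(1-4)] z(2) unfolding xy q by metis
      moreover have "D.on_line c (v + (y' - \<alpha> * x' - (y - \<alpha> * x))) x' (s, x', y')"
        using near[OF z'(5)] by (intro on_line_move[OF p(1) v(2,3)]) (use z' in auto)
      ultimately show ?thesis using z' by (metis less_imp_le)
    qed
    obtain d x1 where d: "0 \<le> x1" "x1 < 1" "\<bar>d\<bar> < \<epsilon>" "D.on_line c (v + d) x1 p'"
      using line[OF pq(1)] by blast
    obtain d' x2 where d': "0 \<le> x2" "x2 < 1" "\<bar>d'\<bar> < \<epsilon>" "D.on_line c (v + d') x2 q'"
      using line[OF pq(2)] by blast
    obtain n x3 where n: "D.on_line (D.iter n (v + d) c) (v + d + real n * \<alpha>) x3 q'"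
      "t = (real n + x3 - x1) * D.\<kappa>"
      using D.flow_on_line[OF _ d(4)] pq(3) unfolding dissipative_flow_def by blast
    have eq: "x3 = x2" "D.iter n (v + d) c = c" "frac (v + d + real n * \<alpha>) = frac (v + d')"
      using D.on_line_unique[OF d'(4) n(1)] by auto
    have "real (D.stable_time + 2) < real n + x3 - x1" using t n(2) D.kappa_pos by simp
    then have "D.stable_time \<le> n" using d(1) d'(2) eq(1) by simp
    have "c \<in> D.image_fibre n (v + d + real n * \<alpha>)"
      using D.iter_in_image_fibre[of n "v + d" c] eq(2) by simp
    also have "\<dots> = D.image_fibre n (v + d')"       using arg_cong[OF eq(3), of "D.image_fibre n"] by (simp only: D.image_fibre_frac)
    \<comment> \<open>Nesting holds at every height, so nongeneric lines of the neighbourhood are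
      covered too.\<close>
    also have "\<dots> \<subseteq> D.attractor (v + d')"
      unfolding D.attractor_def by (rule D.image_fibre_antimono[OF \<open>D.stable_time \<le> n\<close>])
    finally show False using near[OF d'(3)] by blast
  qed
  moreover have "0 \<le> real (D.stable_time + 2) * D.\<kappa>" using D.kappa_pos by simp
  ultimately show ?thesis unfolding wandering_def by blast
qed

text \<open>Returns from \<open>recurrence\<close> are concatenated backwards. This is possible
  because \<open>E\<close> contains at most the square \<open>c\<close>, so each return starts and
  ends there.\<close>

lemma late_return:
  assumes E: "piecewise_const E" "\<And>v. E (v + 1) = E v" "\<And>v. E v \<subseteq> D.attractor v \<inter> {c}"
    and v: "generic \<alpha> (\<lambda>v. (D.\<tau> v, E v)) v" "c \<in> E v"
  shows "\<exists>k\<ge>K. c \<in> E (v - real k * \<alpha>) \<and> D.iter k (v - real k * \<alpha>) c = c"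
proof (induction K)
  case 0
  show ?case using v(2) by (intro exI[of _ "0::nat"]) simp
next
  case (Suc K)
  then obtain k where k: "k \<ge> K" "c \<in> E (v - real k * \<alpha>)" "D.iter k (v - real k * \<alpha>) c = c" by blast
  define w where "w = v - real k * \<alpha>"
  have "generic \<alpha> (\<lambda>v. (D.\<tau> v, E v)) w" unfolding w_def by (rule generic_shift(2)[OF v(1)])
  moreover have "E v \<subseteq> D.attractor v" for v using E(3) by blast
  ultimately obtain j s' where j: "j \<ge> 1" "s' \<in> E (w - real j * \<alpha>)" "D.iter j (w - real j * \<alpha>) s' = c"
    using D.recurrence[OF E(1,2) _ _ k(2)[folded w_def]] by blast
  have "s' = c" using j(2) E(3) by blast
  have eq: "v - real (k + j) * \<alpha> = w - real j * \<alpha>" by (simp add: w_def algebra_simps)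
  have "D.iter (k + j) (w - real j * \<alpha>) c = c"
    using j(3) k(3) \<open>s' = c\<close> D.iter_add[of k j "w - real j * \<alpha>"] by (simp add: w_def)
  then have "c \<in> E (v - real (k + j) * \<alpha>) \<and> D.iter (k + j) (v - real (k + j) * \<alpha>) c = c"
    using j(2) \<open>s' = c\<close> unfolding eq by blast
  moreover have "Suc K \<le> k + j" using j(1) k(1) by simp
  ultimately show ?case by blast
qed

text \<open>The target is \<open>c\<close> over heights near \<open>v\<close>. A late return within
  it gives two points of the neighbourhood with the same \<open>x\<close>, one carried to the other
  after a time that is an arbitrarily large multiple of \<open>D.\<kappa>\<close>.\<close>

lemma nonwandering_on_attractor:
  assumes v: "generic \<alpha> D.\<tau> v" "0 < v" "v < 1" and c: "c \<in> D.attractor v"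
    and p: "D.on_line c v x (s, x, y)" "0 < x" "x < 1" "0 < y" "y < 1"
  shows "\<not> wandering r u \<alpha> a b J (surface_pt r u (s, x, y))"
proof
  assume "wandering r u \<alpha> a b J (surface_pt r u (s, x, y))"
  then obtain D' t0 where D': "surface_open r u D'" "surface_pt r u (s, x, y) \<in> D'"
    and t0: "\<And>t. t > t0 \<Longrightarrow> D' \<inter> dissipative_image r u \<alpha> a b J t D' = {}"
    unfolding wandering_def by blast
  have "(x, y) \<in> part_in_square r u D' s" "openin (top_of_set closed_square) (part_in_square r u D' s)"
    using D' p by (auto simp: part_in_square_def surface_open_def closed_square_def)
  then obtain U where U: "open U" "part_in_square r u D' s = closed_square \<inter> U" "(x, y) \<in> U"
    unfolding openin_open by blast
  obtain \<epsilon>0 where e0: "\<epsilon>0 > 0" "ball (x, y) \<epsilon>0 \<subseteq> U" using U openE by blast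
  obtain \<epsilon>1 where e1: "\<epsilon>1 > 0" "\<And>w. \<bar>w - v\<bar> < \<epsilon>1 \<Longrightarrow> D.attractor w = D.attractor v"
    using locally_constE[OF D.locally_const_attractor[OF v(1)]] by blast
  \<comment> \<open>Lines closer than this stay in the neighbourhood, keep the same attractor fibre,
    remain inside the square at \<open>x\<close>, and start between 0 and 1.\<close>
  define \<epsilon> where "\<epsilon> = Min {\<epsilon>0, \<epsilon>1, y, 1 - y, v, 1 - v}"
  have e: "\<epsilon> > 0" using e0 e1 p v by (simp add: \<epsilon>_def)
  have near: "surface_pt r u (s, x, y + d) \<in> D' \<and> D.on_line c (v + d) x (s, x, y + d) \<and>
      0 < v + d \<and> v + d < 1 \<and> c \<in> D.attractor (v + d)" if d: "\<bar>d\<bar> < \<epsilon>" for d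
  proof -
    have "\<bar>d\<bar> < \<epsilon>0" "\<bar>d\<bar> < \<epsilon>1" "\<bar>d\<bar> < y" "\<bar>d\<bar> < 1 - y" "\<bar>d\<bar> < v" "\<bar>d\<bar> < 1 - v"
      using d by (simp_all add: \<epsilon>_def)
    then have d': "\<bar>d\<bar> < \<epsilon>0" "\<bar>d\<bar> < \<epsilon>1" "0 < y + d" "y + d < 1" "0 < v + d" "v + d < 1"
      by linarith+
    have "(x, y + d) \<in> ball (x, y) \<epsilon>0" using d'(1) by (simp add: dist_Pair_Pair dist_real_def)
    then have "(x, y + d) \<in> closed_square \<inter> U"
      using p(2,3) d'(3,4) e0(2) by (auto simp: closed_square_def)
    then have "surface_pt r u (s, x, y + d) \<in> D'" using U(2) unfolding part_in_square_def by blast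
    moreover have "D.on_line c (v + d) x (s, x, y + d)"
      by (rule on_line_move[OF p(1) v(2,3)]) (use d' p in auto)
    moreover have "D.attractor (v + d) = D.attractor v" using d'(2) by (intro e1(2)) simp
    ultimately show ?thesis using d' c by simp
  qed
  define I where "I = {v - \<epsilon><..<v + \<epsilon>}"
  define E where "E w = (if frac w \<in> I then {c} \<inter> D.attractor w else {})" for w
  have E: "piecewise_const E" "\<And>w. E (w + 1) = E w" "\<And>w. E w \<subseteq> D.attractor w \<inter> {c}"
  proof -
    have "piecewise_const (\<lambda>w. frac w \<in> I)"
      by (rule piecewise_const_frac_in[of "v - \<epsilon>" "v + \<epsilon>"]) (auto simp: I_def)
    from piecewise_const_comp2[OF this D.piecewise_const_attractor,
        of "\<lambda>t A. if t then {c} \<inter> A else {}"]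
    show "piecewise_const E" by (simp add: E_def[abs_def])
    show "E (w + 1) = E w" for w by (simp add: E_def frac_1_eq D.attractor_periodic)
    show "E w \<subseteq> D.attractor w \<inter> {c}" for w by (simp add: E_def)
  qed
  \<comment> \<open>The orbit of \<open>v\<close> itself may meet a discontinuity of
    \<open>E\<close>, such as an endpoint of \<open>I\<close>. So a nearby height that is generic
    for the pair is used as the end of the return.\<close>
  obtain z where z: "v - \<epsilon> < z" "z < v + \<epsilon>" "generic \<alpha> (\<lambda>v. (D.\<tau> v, E v)) z"
    using generic_dense[OF piecewise_const_comp2[OF D.piecewise E(1), of Pair], of "v - \<epsilon>" "v + \<epsilon>" \<alpha>] e
    by auto
  have zv: "\<bar>z - v\<bar> < \<epsilon>" using z by (simp add: abs_less_iff)
  note z' = near[OF this]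
  then have "frac z = z" by (simp add: frac_eq)
  then have "c \<in> E z" using z' z by (simp add: E_def I_def)
  obtain K :: nat where K: "t0 < real K * D.\<kappa>"
    using reals_Archimedean3[OF D.kappa_pos] by blast
  obtain k where k: "k \<ge> K" "c \<in> E (z - real k * \<alpha>)" "D.iter k (z - real k * \<alpha>) c = c"
    using late_return[OF E z(3) \<open>c \<in> E z\<close>] by blast
  define w where "w = frac (z - real k * \<alpha>)"
  have "w \<in> I" using k(2) by (simp add: E_def w_def split: if_splits)
  then have wv: "\<bar>w - v\<bar> < \<epsilon>" by (auto simp: I_def abs_less_iff)
  note w' = near[OF this]
  have "generic \<alpha> (\<lambda>v. (D.\<tau> v, E v)) w"
    using generic_shift(2)[OF z(3), of k] unfolding w_def
    by (subst generic_frac) (auto simp: D.periodic E(2))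
  moreover have "D.on_line c w x (s, x, y + (w - v))" using w' by simp
  moreover have "D.on_line (D.iter k w c) (w + real k * \<alpha>) x (s, x, y + (z - v))"
  proof -
    have "D.iter k w c = c" using k(3) by (simp add: w_def D.iter_frac)
    moreover have "frac (w + real k * \<alpha>) = z" using \<open>frac z = z\<close> by (simp add: w_def frac_frac_add)
    ultimately show ?thesis
      using z' D.on_line_frac[of c "w + real k * \<alpha>" x] by simp
  qed
  ultimately have "flow r u \<alpha> (\<lambda>c y. if c = b \<and> y \<in> J then a else c) ((real k + x - x) * D.\<kappa>)
      (s, x, y + (w - v)) (s, x, y + (z - v))"
    by (rule D.flow_exists) simp
  then have "dissipative_flow r u \<alpha> a b J (real k * D.\<kappa>) (s, x, y + (w - v)) (s, x, y + (z - v))"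
    by (simp add: dissipative_flow_def)
  then have "surface_pt r u (s, x, y + (z - v)) \<in> dissipative_image r u \<alpha> a b J (real k * D.\<kappa>) D'"
    unfolding dissipative_image_def using w' by blast
  moreover have "t0 < real k * D.\<kappa>"
    using K k(1) D.kappa_pos by (meson le_less_trans less_le_trans mult_right_mono of_nat_le_iff less_imp_le)
  ultimately show False using t0 z' by blast
qed

lemma transient_polygons: "finite_union_of_polygons r u \<alpha> (transient_set r u \<alpha> a b J)"
proof (rule D.finite_union_of_polygons_sections[of D.\<tau> "\<lambda>v. - D.attractor v"])
  fix c v s x y
  assume *: "generic \<alpha> D.\<tau> v" "0 < v" "v < 1" "0 < x" "x < 1" "0 < y" "y < 1" "D.on_line c v x (s, x, y)"
  have "surface_pt r u (s, x, y) \<in> surface r u"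
    unfolding surface_def closed_square_def using * by auto
  then show "surface_pt r u (s, x, y) \<in> transient_set r u \<alpha> a b J \<longleftrightarrow> c \<in> - D.attractor v"
    using wandering_off_attractor[OF *(1-3) _ *(8,4-7)] nonwandering_on_attractor[OF *(1-3) _ *(8,4-7)]
    by (auto simp: transient_set_def)
qed (auto intro: D.piecewise D.periodic piecewise_const_comp locally_const_comp
    D.piecewise_const_attractor D.locally_const_attractor)

lemma recurrent_polygons: "finite_union_of_polygons r u \<alpha> (recurrent_set r u \<alpha> a b J)"
proof (rule D.finite_union_of_polygons_sections[of D.\<tau> D.attractor])
  fix c v s x y
  assume *: "generic \<alpha> D.\<tau> v" "0 < v" "v < 1" "0 < x" "x < 1" "0 < y" "y < 1" "D.on_line c v x (s, x, y)"
  have "surface_pt r u (s, x, y) \<in> surface r u"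
    unfolding surface_def closed_square_def using * by auto
  then show "surface_pt r u (s, x, y) \<in> recurrent_set r u \<alpha> a b J \<longleftrightarrow> c \<in> D.attractor v"
    using wandering_off_attractor[OF *(1-3) _ *(8,4-7)] nonwandering_on_attractor[OF *(1-3) _ *(8,4-7)]
    by (auto simp: recurrent_set_def)
qed (auto intro: D.piecewise D.periodic D.piecewise_const_attractor D.locally_const_attractor)

end

theorem theorem5:
  fixes r u :: "'s::finite \<Rightarrow> 's" and \<alpha> :: real and a b :: 's
    and \<I> :: "real set set" and J :: "real set"
  assumes "polysquare r u"
    and "\<alpha> > 0" and "\<alpha> \<notin> \<rat>"
    and "a \<in> street r b" and "a \<noteq> b"
    and "finite \<I>" and "\<forall>I\<in>\<I>. rational_interval I" and "J = \<Union>\<I>" and "J \<subseteq> {0..<1}"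
  shows "extension_process_terminates r u \<alpha> a b J \<and>
    finite_union_of_polygons r u \<alpha> (transient_set r u \<alpha> a b J) \<and>
    finite_union_of_polygons r u \<alpha> (recurrent_set r u \<alpha> a b J)"
proof -
  have "piecewise_const (\<lambda>v. frac v \<in> I)" if "I \<in> \<I>" for I
    using that assms(7) piecewise_const_frac_in unfolding rational_interval_def by blast
  then have "piecewise_const (\<lambda>v. frac v \<in> J)"
    unfolding assms(8) by (rule piecewise_const_frac_in_Union[OF assms(6)])
  then interpret barrier r u \<alpha> a b J
    using assms by unfold_locales (simp_all add: polysquare_def)
  show ?thesis using terminates transient_polygons recurrent_polygons by blast
qed

end
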